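(* For all $a,b,c\ge 0$, the minimal $Q$-free resolution of $Q/I_{L(a,b,c)}$ admits the structure of a differential graded algebra.
   Context: $L(a,b,c)$ is the graph with vertex set $\{x,y\}\cup\{x_i\}_{i=1}^a\cup\{y_j\}_{j=1}^b\cup\{z_k\}_{k=1}^c$ and edges $\{x,y\}$, $\{x,x_i\}$, $\{y,y_j\}$, $\{x,z_k\},\{y,z_k\}$; $Q$ is the polynomial ring over a field $\Bbbk$ in these vertices, and $I_{L(a,b,c)}$ is its edge ideal. (These are exactly the graphs whose edge ideals have a minimal Lyubeznik resolution.) A differential graded (dg) algebra structure on a complex of free $Q$-modules is a unital associative multiplication satisfying $\mathcal{A}_i\mathcal{A}_j\subseteq\mathcal{A}_{i+j}$, $ab=(-1)^{|a||b|}ba$, $a^2=0$ for $|a|$ odd, and the Leibniz rule $\partial(ab)=\partial(a)b+(-1)^{|a|}a\partial(b)$. *)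

theory Defs
  imports Main "HOL-Library.Poly_Mapping"
begin

datatype vtx = VX | VY | VXi nat | VYj nat | VZk nat

definition Lverts :: "nat \<Rightarrow> nat \<Rightarrow> nat \<Rightarrow> vtx set" where
  "Lverts a b c = {VX, VY} \<union> VXi ` {1..a} \<union> VYj ` {1..b} \<union> VZk ` {1..c}"

text \<open>Edges of L(a,b,c), as (unordered) pairs written once.\<close>
definition Ledges :: "nat \<Rightarrow> nat \<Rightarrow> nat \<Rightarrow> (vtx \<times> vtx) set" where
  "Ledges a b c = {(VX, VY)} \<union> (\<lambda>i. (VX, VXi i)) ` {1..a} \<union> (\<lambda>j. (VY, VYj j)) ` {1..b}
     \<union> (\<lambda>k. (VX, VZk k)) ` {1..c} \<union> (\<lambda>k. (VY, VZk k)) ` {1..c}"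

type_synonym 'k mpoly = "(vtx \<Rightarrow>\<^sub>0 nat) \<Rightarrow>\<^sub>0 'k"

definition polyring :: "vtx set \<Rightarrow> ('k::zero) mpoly set" where
  "polyring V = {p :: 'k mpoly. \<forall>m \<in> Poly_Mapping.keys p. Poly_Mapping.keys m \<subseteq> V}"

definition var_mono :: "vtx \<Rightarrow> vtx \<Rightarrow> ('k::{zero,one}) mpoly" where
  "var_mono u v = Poly_Mapping.single (Poly_Mapping.single u 1 + Poly_Mapping.single v 1) 1"

definition edge_ideal :: "nat \<Rightarrow> nat \<Rightarrow> nat \<Rightarrow> ('k::comm_ring_1) mpoly set" where
  "edge_ideal a b c = {(\<Sum>e\<in>Ledges a b c. g e * var_mono (fst e) (snd e)) | g.
      \<forall>e. g e \<in> polyring (Lverts a b c)}"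

definition mdeg :: "(vtx \<Rightarrow>\<^sub>0 nat) \<Rightarrow> nat" where
  "mdeg m = (\<Sum>v\<in>Poly_Mapping.keys m. Poly_Mapping.lookup m v)"

definition homogeneous :: "nat \<Rightarrow> ('k::zero) mpoly \<Rightarrow> bool" where
  "homogeneous t p \<longleftrightarrow> (\<forall>m\<in>Poly_Mapping.keys p. mdeg m = t)"

text \<open>A complex of finitely generated free Q-modules F_i = Q^(r i) (i >= 0);
  elements of F_i are coefficient vectors, zero outside indices < r i.
  The differential F_i -> F_(i-1) (i >= 1) is given by the matrix d i.\<close>
definition fmod :: "vtx set \<Rightarrow> (nat \<Rightarrow> nat) \<Rightarrow> nat \<Rightarrow> (nat \<Rightarrow> ('k::zero) mpoly) set" where
  "fmod V r i = {v. (\<forall>p. v p \<in> polyring V) \<and> (\<forall>p. r i \<le> p \<longrightarrow> v p = 0)}"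

definition diff :: "(nat \<Rightarrow> nat \<Rightarrow> nat \<Rightarrow> ('k::comm_ring_1) mpoly) \<Rightarrow> (nat \<Rightarrow> nat) \<Rightarrow> nat
    \<Rightarrow> (nat \<Rightarrow> 'k mpoly) \<Rightarrow> (nat \<Rightarrow> 'k mpoly)" where
  "diff d r i v = (\<lambda>p. if i = 0 then 0
      else if p < r (i - 1) then (\<Sum>q<r i. d i p q * v q) else 0)"

text \<open>(F, d) with augmentation F_0 = Q -> Q/I is a minimal graded free resolution of Q/I:
  r 0 = 1, entries in Q, exact at every F_i (i >= 1), image of F_1 -> F_0 = Q is I,
  the matrices are homogeneous w.r.t. degrees dg i p of the basis elements (dg 0 0 = 0),
  and minimal: d(F) is contained in mF, m = (vertices), i.e. no entry has a constant term.\<close>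
definition minimal_free_resolution ::
  "vtx set \<Rightarrow> ('k::comm_ring_1) mpoly set \<Rightarrow> (nat \<Rightarrow> nat) \<Rightarrow> (nat \<Rightarrow> nat \<Rightarrow> nat \<Rightarrow> 'k mpoly) \<Rightarrow> bool" where
  "minimal_free_resolution V I r d \<longleftrightarrow>
     r 0 = 1 \<and>
     (\<forall>i p q. 1 \<le> i \<longrightarrow> d i p q \<in> polyring V) \<and>
     (\<lambda>v. v 0) ` (diff d r 1 ` fmod V r 1) = I \<and>
     (\<forall>i\<ge>1. {v \<in> fmod V r i. diff d r i v = (\<lambda>_. 0)} = diff d r (i + 1) ` fmod V r (i + 1)) \<and>
     (\<exists>dg :: nat \<Rightarrow> nat \<Rightarrow> nat. dg 0 0 = 0 \<and>
        (\<forall>i p q. 1 \<le> i \<longrightarrow> p < r (i - 1) \<longrightarrow> q < r i \<longrightarrow>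
           d i p q = 0 \<or> (dg (i - 1) p \<le> dg i q \<and> homogeneous (dg i q - dg (i - 1) p) (d i p q)))) \<and>
     (\<forall>i p q. 1 \<le> i \<longrightarrow> Poly_Mapping.lookup (d i p q) 0 = 0)"

text \<open>A Q-bilinear multiplication F_i x F_j -> F_(i+j), given by structure constants
  mu i j p q s: e^i_p * e^j_q = sum_s mu i j p q s * e^(i+j)_s.\<close>
definition mult :: "(nat \<Rightarrow> nat) \<Rightarrow> (nat \<Rightarrow> nat \<Rightarrow> nat \<Rightarrow> nat \<Rightarrow> nat \<Rightarrow> ('k::comm_ring_1) mpoly)
    \<Rightarrow> nat \<Rightarrow> nat \<Rightarrow> (nat \<Rightarrow> 'k mpoly) \<Rightarrow> (nat \<Rightarrow> 'k mpoly) \<Rightarrow> (nat \<Rightarrow> 'k mpoly)" where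
  "mult r mu i j v w = (\<lambda>s. if s < r (i + j)
      then (\<Sum>p<r i. \<Sum>q<r j. v p * w q * mu i j p q s) else 0)"

definition dg_algebra_structure ::
  "vtx set \<Rightarrow> (nat \<Rightarrow> nat) \<Rightarrow> (nat \<Rightarrow> nat \<Rightarrow> nat \<Rightarrow> ('k::comm_ring_1) mpoly)
     \<Rightarrow> (nat \<Rightarrow> nat \<Rightarrow> nat \<Rightarrow> nat \<Rightarrow> nat \<Rightarrow> 'k mpoly) \<Rightarrow> bool" where
  "dg_algebra_structure V r d mu \<longleftrightarrow>
     (\<forall>i j p q s. mu i j p q s \<in> polyring V) \<and>
     (\<exists>u \<in> fmod V r 0. \<forall>j. \<forall>v \<in> fmod V r j. mult r mu 0 j u v = v \<and> mult r mu j 0 v u = v) \<and>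
     (\<forall>i j k. \<forall>v \<in> fmod V r i. \<forall>w \<in> fmod V r j. \<forall>x \<in> fmod V r k.
        mult r mu (i + j) k (mult r mu i j v w) x = mult r mu i (j + k) v (mult r mu j k w x)) \<and>
     (\<forall>i j. \<forall>v \<in> fmod V r i. \<forall>w \<in> fmod V r j.
        mult r mu i j v w = (\<lambda>s. (-1) ^ (i * j) * mult r mu j i w v s)) \<and>
     (\<forall>i. odd i \<longrightarrow> (\<forall>v \<in> fmod V r i. mult r mu i i v v = (\<lambda>_. 0))) \<and>
     (\<forall>i j. \<forall>v \<in> fmod V r i. \<forall>w \<in> fmod V r j.
        diff d r (i + j) (mult r mu i j v w) =
          (\<lambda>s. mult r mu (i - 1) j (diff d r i v) w s
               + (-1) ^ i * mult r mu i (j - 1) v (diff d r j w) s))"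

end

theory Submission
  imports Defs
begin

text \<open>
  Write \<open>K\<close> for the Koszul algebra on \<open>y, x\<^sub>i, z\<^sub>k\<close> and \<open>L\<close> for the one on \<open>x, y\<^sub>j, z\<^sub>k\<close>;
  the generator of \<open>y\<close> in \<open>K\<close> and that of \<open>x\<close> in \<open>L\<close> are both called \<open>e\<^sub>0\<close>. The minimal
  resolution of \<open>Q/I\<close> is supported on two simplices that share the vertex of the edge \<open>xy\<close>, and it
  embeds into \<open>K \<times> L\<close>: the basis element of \<open>xy\<close> goes to \<open>(x e\<^sub>0, y e\<^sub>0)\<close>, that of \<open>xs\<close> to
  \<open>(x e\<^sub>s, s e\<^sub>0)\<close>, that of \<open>yt\<close> to \<open>(t e\<^sub>0, y e\<^sub>t)\<close>, and the image in degrees \<open>n \<ge> 2\<close> is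
  \<open>x K\<^sub>n \<times> y L\<^sub>n\<close>. This image is closed under the product, because \<open>e\<^sub>0 e\<^sub>0 = 0\<close> makes every
  product of two elements of positive degree divisible by \<open>x\<close> in \<open>K\<close> and by \<open>y\<close> in \<open>L\<close>. Hence
  all the laws of a dg algebra are inherited from \<open>K \<times> L\<close>, and exactness is inherited from the
  exactness of the two Koszul complexes.
\<close>

section \<open>Exterior algebra and Koszul differential\<close>

text \<open>For disjoint finite \<open>A\<close> and \<open>B\<close> this is the sign in e_A e_B =
  \<open>shsgn A B\<close> e_(A \<union> B): a factor -1 for every pair that is out of
  order.\<close>

definition shsgn :: "nat set \<Rightarrow> nat set \<Rightarrow> 'r::comm_ring_1" where
  "shsgn A B = (\<Prod>i\<in>A. \<Prod>j\<in>B. if j < i then - 1 else 1)"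

text \<open>An element of the exterior algebra is encoded as its coefficient function on index sets.
  No finiteness is demanded of these sets; at an infinite \<open>U\<close> the sum over
  \<open>Pow U\<close> is 0 by default, so products vanish there.\<close>

definition wedge :: "(nat set \<Rightarrow> 'r::comm_ring_1) \<Rightarrow> (nat set \<Rightarrow> 'r) \<Rightarrow> nat set \<Rightarrow> 'r" where
  "wedge u v U = (\<Sum>S\<in>Pow U. shsgn S (U - S) * u S * v (U - S))"

text \<open>Contraction with the dual of e_i. The sign is that of e_i e_U: the generator e_i is
  pulled to the front before it is removed.\<close>

definition contr :: "nat \<Rightarrow> (nat set \<Rightarrow> 'r::comm_ring_1) \<Rightarrow> nat set \<Rightarrow> 'r" where
  "contr i u U = (if i \<in> U then 0 else shsgn {i} U * u (insert i U))"

definition kdiff :: "nat set \<Rightarrow> (nat \<Rightarrow> 'r::comm_ring_1) \<Rightarrow> (nat set \<Rightarrow> 'r) \<Rightarrow> nat set \<Rightarrow> 'r" where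
  "kdiff N X u U = (\<Sum>i\<in>N. X i * contr i u U)"

lemma shsgn_empty [simp]: "shsgn {} B = 1" "shsgn A {} = 1"
  by (simp_all add: shsgn_def)

lemma shsgn_Un_left:
  "finite A \<Longrightarrow> finite B \<Longrightarrow> A \<inter> B = {} \<Longrightarrow> shsgn (A \<union> B) C = shsgn A C * shsgn B C"
  by (simp add: shsgn_def prod.union_disjoint)

lemma shsgn_Un_right:
  "finite B \<Longrightarrow> finite C \<Longrightarrow> B \<inter> C = {} \<Longrightarrow> shsgn A (B \<union> C) = shsgn A B * shsgn A C"
  by (simp add: shsgn_def prod.union_disjoint prod.distrib)

lemma shsgn_insert_left:
  "finite A \<Longrightarrow> i \<notin> A \<Longrightarrow> shsgn (insert i A) C = shsgn {i} C * shsgn A C"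
  by (simp add: shsgn_def)

lemma shsgn_insert_right:
  "finite B \<Longrightarrow> i \<notin> B \<Longrightarrow> shsgn A (insert i B) = shsgn A {i} * shsgn A B"
  by (simp add: shsgn_def prod.distrib)

lemma shsgn_square: "shsgn A B * shsgn A B = 1"
proof -
  have "shsgn A B * shsgn A B = (\<Prod>i\<in>A. \<Prod>j\<in>B. (if j < i then - 1 else 1) * (if j < i then - 1 else 1 :: 'a))"
    unfolding shsgn_def by (simp only: prod.distrib)
  also have "\<dots> = 1" by (intro prod.neutral ballI) auto
  finally show ?thesis .
qed

lemma shsgn_square_left: "shsgn A B * (shsgn A B * x) = x"
  by (simp add: shsgn_square flip: mult.assoc)

text \<open>For finite sets, each of the \<open>card A * card B\<close> pairs is out of order in
  exactly one of the two arrangements.\<close>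

lemma shsgn_swap:
  assumes "A \<inter> B = {}"
  shows "shsgn A B * shsgn B A = (- 1) ^ (card A * card B)"
proof -
  have "shsgn B A = (\<Prod>i\<in>A. \<Prod>j\<in>B. if i < j then - 1 else 1 :: 'a)"
    unfolding shsgn_def by (rule prod.swap)
  then have "shsgn A B * shsgn B A
      = (\<Prod>i\<in>A. \<Prod>j\<in>B. (if j < i then - 1 else 1) * (if i < j then - 1 else 1 :: 'a))"
    unfolding shsgn_def by (simp only: prod.distrib)
  also have "\<dots> = (\<Prod>i\<in>A. \<Prod>j\<in>B. - 1)"
    using assms by (intro prod.cong refl) (auto simp: not_less_iff_gr_or_eq)
  also have "\<dots> = (- 1) ^ (card A * card B)"
    by (simp add: power_mult[symmetric] mult.commute)
  finally show ?thesis .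
qed

lemma shsgn_swap_eq:
  assumes "A \<inter> B = {}"
  shows "shsgn A B = (- 1) ^ (card A * card B) * shsgn B A"
  by (metis assms shsgn_square shsgn_swap mult.assoc mult.right_neutral)

lemma shsgn_swap_singleton:
  assumes "i \<notin> A"
  shows "shsgn A {i} = (- 1) ^ card A * shsgn {i} A"
  using shsgn_swap_eq[of A "{i}"] assms by simp

text \<open>Both sides run over the ordered partitions of \<open>U\<close> into three blocks R, T,
  W, and both signs are the product of the three pairwise signs. The reindexing replaces the pair (R
  \<union> T, R) by (R, T).\<close>

lemma wedge_assoc: "wedge (wedge u v) w U = wedge u (wedge v w) U"
proof (cases "finite U")
  case True
  have "wedge (wedge u v) w U = (\<Sum>S\<in>Pow U. \<Sum>R\<in>Pow S.
      shsgn S (U - S) * (shsgn R (S - R) * u R * v (S - R)) * w (U - S))"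
    by (simp add: wedge_def sum_distrib_left sum_distrib_right)
  also have "\<dots> = (\<Sum>(S, R)\<in>(SIGMA S:Pow U. Pow S).
      shsgn S (U - S) * (shsgn R (S - R) * u R * v (S - R)) * w (U - S))"
    using True by (subst sum.Sigma) (auto intro: finite_subset)
  also have "\<dots> = (\<Sum>(R, T)\<in>(SIGMA R:Pow U. Pow (U - R)).
      shsgn R (U - R) * u R * (shsgn T (U - R - T) * v T * w (U - R - T)))"
  proof (rule sum.reindex_bij_witness[where i = "\<lambda>(R, T). (R \<union> T, R)" and j = "\<lambda>(S, R). (R, S - R)"])
    fix SR assume "SR \<in> (SIGMA S:Pow U. Pow S)"
    then obtain S R where [simp]: "SR = (S, R)" and S: "S \<subseteq> U" "R \<subseteq> S" by auto
    define T where "T = S - R"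
    define W where "W = U - S"
    have fin: "finite R" "finite T" "finite W"
      using S True by (auto simp: T_def W_def intro: finite_subset)
    have e: "S = R \<union> T" "R \<inter> T = {}" "U - R = T \<union> W" "T \<inter> W = {}" "U - R - T = W" "S - R = T" "U - S = W"
      using S by (auto simp: T_def W_def)
    have "shsgn S W * shsgn R T = shsgn R (U - R) * (shsgn T W :: 'a)"
      using fin e(2,4) by (simp add: e(1,3) shsgn_Un_left shsgn_Un_right mult.commute mult.left_commute)
    then have "shsgn R (U - R) * u R * (shsgn T W * v T * w W) = shsgn S W * (shsgn R T * u R * v T) * w W"
      by (metis (no_types, lifting) mult.assoc mult.left_commute)
    then show "(case case SR of (S, R) \<Rightarrow> (R, S - R) of (R, T) \<Rightarrow>
        shsgn R (U - R) * u R * (shsgn T (U - R - T) * v T * w (U - R - T))) =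
      (case SR of (S, R) \<Rightarrow> shsgn S (U - S) * (shsgn R (S - R) * u R * v (S - R)) * w (U - S))"
      using e(5-7) by simp
  qed auto
  also have "\<dots> = (\<Sum>R\<in>Pow U. \<Sum>T\<in>Pow (U - R).
      shsgn R (U - R) * u R * (shsgn T (U - R - T) * v T * w (U - R - T)))"
    using True by (subst sum.Sigma) auto
  also have "\<dots> = wedge u (wedge v w) U"
    by (simp add: wedge_def sum_distrib_left)
  finally show ?thesis .
qed (simp add: wedge_def)

definition hom_deg :: "nat \<Rightarrow> (nat set \<Rightarrow> 'r::zero) \<Rightarrow> bool" where
  "hom_deg i u \<longleftrightarrow> (\<forall>S. u S \<noteq> 0 \<longrightarrow> card S = i)"

lemma wedge_commute:
  assumes "hom_deg i u" "hom_deg j v"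
  shows "wedge u v U = (- 1) ^ (i * j) * wedge v u U"
proof -
  have "wedge u v U = (\<Sum>S\<in>Pow U. shsgn (U - S) S * u (U - S) * v S)"
    unfolding wedge_def
    by (rule sum.reindex_bij_witness[where i = "\<lambda>S. U - S" and j = "\<lambda>S. U - S"])
       (auto simp: double_diff)
  also have "\<dots> = (\<Sum>S\<in>Pow U. (- 1) ^ (i * j) * (shsgn S (U - S) * v S * u (U - S)))"
  proof (rule sum.cong[OF refl])
    fix S assume "S \<in> Pow U"
    show "shsgn (U - S) S * u (U - S) * v S = (- 1) ^ (i * j) * (shsgn S (U - S) * v S * u (U - S))"
    proof (cases "u (U - S) = 0 \<or> v S = 0")
      case False
      then have "card (U - S) = i" "card S = j" using assms by (auto simp: hom_deg_def)
      then have "shsgn (U - S) S = (- 1) ^ (i * j) * (shsgn S (U - S) :: 'a)"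
        using shsgn_swap_eq[of "U - S" S] by auto
      then show ?thesis by (simp add: algebra_simps)
    qed auto
  qed
  also have "\<dots> = (- 1) ^ (i * j) * wedge v u U"
    by (simp add: wedge_def sum_distrib_left)
  finally show ?thesis .
qed

text \<open>Graded commutativity would only give 2 u u = 0, which is empty in characteristic 2.
  Instead the terms of \<open>S\<close> and of its complement cancel in pairs; a fixed
  \<open>m\<close> in \<open>U\<close> selects one member of each pair.\<close>

lemma wedge_self_odd:
  assumes "hom_deg i u" "odd i"
  shows "wedge u u U = 0"
proof (cases "finite U \<and> U \<noteq> {}")
  case False
  have "u {} = 0" using assms by (auto simp: hom_deg_def)
  then show ?thesis using False by (auto simp: wedge_def)
next
  case True
  then obtain m where m: "m \<in> U" by auto
  let ?f = "\<lambda>S. shsgn S (U - S) * u S * u (U - S)"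
  let ?A = "{S \<in> Pow U. m \<in> S}" and ?B = "{S \<in> Pow U. m \<notin> S}"
  have "wedge u u U = sum ?f (?A \<union> ?B)"
    unfolding wedge_def by (rule sum.cong) auto
  also have "\<dots> = sum ?f ?A + sum ?f ?B"
    using True by (intro sum.union_disjoint) auto
  also have "sum ?f ?B = (\<Sum>S\<in>?A. - ?f S)"
  proof (rule sum.reindex_bij_witness[where i = "\<lambda>S. U - S" and j = "\<lambda>S. U - S"])
    fix S assume S: "S \<in> ?B"
    show "- (shsgn (U - S) (U - (U - S)) * u (U - S) * u (U - (U - S))) = ?f S"
    proof (cases "u (U - S) = 0 \<or> u S = 0")
      case False
      then have c: "card (U - S) = i" "card S = i" using assms by (auto simp: hom_deg_def)
      then have "shsgn (U - S) S = - (shsgn S (U - S) :: 'a)"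
        using shsgn_swap_eq[of "U - S" S] assms by auto
      then show ?thesis using S by (simp add: double_diff algebra_simps)
    next
      case True
      then show ?thesis using S by (auto simp: double_diff)
    qed
  qed (use m in \<open>auto simp: double_diff\<close>)
  finally show ?thesis by (simp add: sum_negf)
qed

section \<open>Contractions, the Leibniz rule and d d = 0\<close>

lemma sum_Pow_insert:
  assumes "finite U" "i \<notin> U"
  shows "sum f (Pow (insert i U)) = (\<Sum>S\<in>Pow U. f (insert i S)) + sum f (Pow U)"
proof -
  have "sum f (Pow (insert i U)) = sum f (Pow U) + sum f (insert i ` Pow U)"
    unfolding Pow_insert using assms by (intro sum.union_disjoint) auto
  also have "sum f (insert i ` Pow U) = (\<Sum>S\<in>Pow U. f (insert i S))"
    using assms by (subst sum.reindex) (auto simp: inj_on_def)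
  finally show ?thesis by (simp add: add.commute)
qed

text \<open>For \<open>i\<close> outside \<open>U\<close>, the subsets of \<open>insert i U\<close>
  that contain \<open>i\<close> give the first product and the others give the second. For
  \<open>i\<close> in \<open>U\<close> the left side is 0 and the two products cancel.\<close>

lemma contr_wedge:
  assumes "finite U" and u: "hom_deg n u"
  shows "contr i (wedge u v) U = wedge (contr i u) v U + (- 1) ^ n * wedge u (contr i v) U"
proof (cases "i \<in> U")
  case False
  have "contr i (wedge u v) U = (\<Sum>S\<in>Pow U. shsgn {i} U * (shsgn (insert i S) (U - S) * u (insert i S) * v (U - S)))
      + (\<Sum>S\<in>Pow U. shsgn {i} U * (shsgn S (insert i (U - S)) * u S * v (insert i (U - S))))"
  proof -
    have "insert i U - insert i S = U - S" "insert i U - S = insert i (U - S)" if "S \<in> Pow U" for S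
      using that False by auto
    then show ?thesis using False
      unfolding contr_def wedge_def sum_Pow_insert[OF assms(1) False] distrib_left sum_distrib_left
      by (auto intro!: arg_cong2[where f = "(+)"] sum.cong)
  qed
  also have "(\<Sum>S\<in>Pow U. shsgn {i} U * (shsgn (insert i S) (U - S) * u (insert i S) * v (U - S)))
      = wedge (contr i u) v U"
    unfolding wedge_def
  proof (rule sum.cong[OF refl])
    fix S assume "S \<in> Pow U"
    then have S: "S \<subseteq> U" "finite S" "i \<notin> S" "i \<notin> U - S" "finite (U - S)" "S \<union> (U - S) = U"
      using False assms(1) by (auto intro: finite_subset)
    have "shsgn {i} U = shsgn {i} S * (shsgn {i} (U - S) :: 'a)"
      using shsgn_Un_right[of S "U - S" "{i}"] S by simp
    then show "shsgn {i} U * (shsgn (insert i S) (U - S) * u (insert i S) * v (U - S))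
        = shsgn S (U - S) * contr i u S * v (U - S)"
      using S by (simp add: contr_def shsgn_insert_left[OF S(2,3)] ac_simps shsgn_square_left shsgn_square)
  qed
  also have "(\<Sum>S\<in>Pow U. shsgn {i} U * (shsgn S (insert i (U - S)) * u S * v (insert i (U - S))))
      = (- 1) ^ n * wedge u (contr i v) U"
    unfolding wedge_def sum_distrib_left
  proof (rule sum.cong[OF refl])
    fix S assume "S \<in> Pow U"
    then have S: "S \<subseteq> U" "finite S" "i \<notin> S" "i \<notin> U - S" "finite (U - S)" "S \<union> (U - S) = U"
      using False assms(1) by (auto intro: finite_subset)
    show "shsgn {i} U * (shsgn S (insert i (U - S)) * u S * v (insert i (U - S)))
        = (- 1) ^ n * (shsgn S (U - S) * u S * contr i v (U - S))"
    proof (cases "u S = 0")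
      case False
      then have n: "card S = n" using u by (auto simp: hom_deg_def)
      have "shsgn {i} U = shsgn {i} S * (shsgn {i} (U - S) :: 'a)"
        using shsgn_Un_right[of S "U - S" "{i}"] S by simp
      moreover have "shsgn S {i} = (- 1) ^ n * (shsgn {i} S :: 'a)"
        using shsgn_swap_singleton[OF S(3)] n by simp
      ultimately show ?thesis
        using S by (simp add: contr_def shsgn_insert_right[OF S(5,4)] ac_simps shsgn_square_left shsgn_square)
    qed simp
  qed
  finally show ?thesis .
next
  case True
  \<comment> \<open>Only those splittings survive in which the contracted factor receives no
    \<open>i\<close>. Both products then evaluate \<open>u\<close> at \<open>insert i S\<close> and
    \<open>v\<close> at \<open>insert i (W - S)\<close> for the same \<open>S\<close>, with opposite
    signs.\<close>
  define W where "W = U - {i}"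
  have W: "U = insert i W" "i \<notin> W" "finite W" using True assms(1) by (auto simp: W_def)
  have "wedge (contr i u) v U = (\<Sum>S\<in>Pow W. shsgn S (insert i W - S) * contr i u S * v (insert i W - S))"
    using W by (simp add: wedge_def sum_Pow_insert contr_def)
  also have "\<dots> = (\<Sum>S\<in>Pow W. (- 1) ^ card S * (shsgn S (W - S) * u (insert i S) * v (insert i (W - S))))"
  proof (rule sum.cong[OF refl])
    fix S assume "S \<in> Pow W"
    then have S: "S \<subseteq> W" "finite S" "i \<notin> S" "i \<notin> W - S" "finite (W - S)" "insert i W - S = insert i (W - S)"
      using W by (auto intro: finite_subset)
    show "shsgn S (insert i W - S) * contr i u S * v (insert i W - S)
      = (- 1) ^ card S * (shsgn S (W - S) * u (insert i S) * v (insert i (W - S)))"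
      using S by (simp add: contr_def shsgn_insert_right[OF S(5,4)] shsgn_swap_singleton[OF S(3)] ac_simps shsgn_square_left shsgn_square)
  qed
  finally have 1: "wedge (contr i u) v U = \<dots>" .
  have z: "contr i v (insert i W - S) = 0" if "S \<in> Pow W" for S
    using that W by (auto simp: contr_def)
  have "(- 1) ^ n * wedge u (contr i v) U
      = (\<Sum>S\<in>Pow W. (- 1) ^ n * (shsgn (insert i S) (W - S) * u (insert i S) * contr i v (W - S)))"
    unfolding wedge_def W(1) sum_Pow_insert[OF W(3,2)] using W z
    by (simp add: sum_distrib_left)
  also have "\<dots> = (\<Sum>S\<in>Pow W. - ((- 1) ^ card S * (shsgn S (W - S) * u (insert i S) * v (insert i (W - S)))))"
  proof (rule sum.cong[OF refl])
    fix S assume "S \<in> Pow W"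
    then have S: "S \<subseteq> W" "finite S" "i \<notin> S" "i \<notin> W - S" "finite (W - S)"
      using W by (auto intro: finite_subset)
    show "(- 1) ^ n * (shsgn (insert i S) (W - S) * u (insert i S) * contr i v (W - S))
      = - ((- 1) ^ card S * (shsgn S (W - S) * u (insert i S) * v (insert i (W - S))))"
    proof (cases "u (insert i S) = 0")
      case False
      then have "n = Suc (card S)" using u S by (auto simp: hom_deg_def)
      then show ?thesis
        using S by (simp add: contr_def shsgn_insert_left[OF S(2,3)] ac_simps shsgn_square_left shsgn_square)
    qed simp
  qed
  also have "\<dots> = - wedge (contr i u) v U" by (simp only: 1 sum_negf)
  finally show ?thesis using True by (simp add: contr_def)
qed

lemma wedge_sum_left: "wedge (\<lambda>S. \<Sum>i\<in>N. c i * u i S) v U = (\<Sum>i\<in>N. c i * wedge (u i) v U)"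
  unfolding wedge_def sum_distrib_left sum_distrib_right
  by (subst sum.swap) (simp add: ac_simps)

lemma wedge_sum_right: "wedge u (\<lambda>S. \<Sum>i\<in>N. c i * v i S) U = (\<Sum>i\<in>N. c i * wedge u (v i) U)"
  unfolding wedge_def sum_distrib_left sum_distrib_right
  by (subst sum.swap) (simp add: ac_simps)

lemma kdiff_wedge:
  assumes "finite U" "hom_deg n u"
  shows "kdiff N X (wedge u v) U = wedge (kdiff N X u) v U + (- 1) ^ n * wedge u (kdiff N X v) U"
proof -
  have "kdiff N X (wedge u v) U
      = (\<Sum>i\<in>N. X i * wedge (contr i u) v U) + (- 1) ^ n * (\<Sum>i\<in>N. X i * wedge u (contr i v) U)"
    unfolding kdiff_def using assms
    by (simp add: contr_wedge distrib_left sum.distrib sum_distrib_left ac_simps)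
  then show ?thesis unfolding kdiff_def[abs_def] by (simp add: wedge_sum_left wedge_sum_right)
qed

text \<open>The diagonal is required to vanish on its own, since antisymmetry only yields 2
  \<open>f i i\<close> = 0.\<close>

lemma sum_antisymmetric:
  fixes f :: "'i \<Rightarrow> 'i \<Rightarrow> 'r::ab_group_add"
  assumes "finite N" "\<And>i j. i \<in> N \<Longrightarrow> j \<in> N \<Longrightarrow> f i j = - f j i" "\<And>i. i \<in> N \<Longrightarrow> f i i = 0"
  shows "(\<Sum>i\<in>N. \<Sum>j\<in>N. f i j) = 0"
  using assms
proof (induction N rule: finite_induct)
  case (insert k N)
  have "(\<Sum>i\<in>N. f i k) = (\<Sum>i\<in>N. - f k i)"
    using insert.prems(1) by (intro sum.cong) (blast, blast)
  moreover have "(\<Sum>i\<in>N. \<Sum>j\<in>N. f i j) = 0"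
    by (rule insert.IH) (use insert.prems in blast)+
  moreover have "f k k = 0" using insert.prems(2) by blast
  ultimately show ?case using insert.hyps by (simp add: sum.distrib sum_negf)
qed simp

lemma contr_contr:
  assumes "finite U"
  shows "contr i (contr j u) U = - contr j (contr i u) U"
proof (cases "i \<in> U \<or> j \<in> U \<or> i = j")
  case False
  have "shsgn {i} {j} = - (shsgn {j} {i} :: 'a)"
    using False by (subst shsgn_swap_eq) auto
  then show ?thesis using False assms
    by (simp add: contr_def shsgn_insert_right[OF assms] insert_commute ac_simps)
qed (auto simp: contr_def)

lemma contr_contr_same: "contr i (contr i u) U = 0"
  by (simp add: contr_def)

lemma contr_sum: "contr j (\<lambda>S. \<Sum>i\<in>N. c i * u i S) U = (\<Sum>i\<in>N. c i * contr j (u i) U)"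
  by (simp add: contr_def sum_distrib_left ac_simps)

text \<open>Contractions anticommute and square to zero, so the double sum over pairs of indices is
  antisymmetric with zero diagonal.\<close>

lemma kdiff_kdiff:
  assumes "finite N" "finite U"
  shows "kdiff N X (kdiff N X u) U = 0"
proof -
  have "kdiff N X (kdiff N X u) U = (\<Sum>i\<in>N. \<Sum>j\<in>N. X i * (X j * contr i (contr j u) U))"
    unfolding kdiff_def[abs_def] by (simp add: contr_sum sum_distrib_left)
  also have "\<dots> = 0"
  proof (rule sum_antisymmetric[OF assms(1)])
    fix i j
    show "X i * (X j * contr i (contr j u) U) = - (X j * (X i * contr j (contr i u) U))"
      using contr_contr[OF assms(2), of i j u] by (simp add: ac_simps)
  qed (simp add: contr_contr_same)
  finally show ?thesis .
qed

lemma kdiff_sum: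
  "kdiff N X (\<lambda>S. \<Sum>i\<in>I. c i * u i S) U = (\<Sum>i\<in>I. c i * kdiff N X (u i) U)"
proof -
  have "kdiff N X (\<lambda>S. \<Sum>i\<in>I. c i * u i S) U = (\<Sum>j\<in>N. \<Sum>i\<in>I. c i * (X j * contr j (u i) U))"
    by (simp add: kdiff_def contr_sum sum_distrib_left ac_simps)
  also have "\<dots> = (\<Sum>i\<in>I. \<Sum>j\<in>N. c i * (X j * contr j (u i) U))"
    by (rule sum.swap)
  finally show ?thesis by (simp add: kdiff_def sum_distrib_left)
qed

lemma kdiff_scale: "kdiff N X (\<lambda>S. t * u S) U = t * kdiff N X u U"
  using kdiff_sum[where I = "{()}" and c = "\<lambda>_. t" and u = "\<lambda>_. u"] by simp

lemma kdiff_add: "kdiff N X (\<lambda>S. u S + v S) U = kdiff N X u U + kdiff N X v U"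
  unfolding kdiff_def sum.distrib[symmetric]
  by (rule sum.cong) (auto simp: contr_def algebra_simps)

lemma kdiff_uminus: "kdiff N X (\<lambda>S. - u S) U = - kdiff N X u U"
  using kdiff_scale[of N X "- 1" u U] by simp

section \<open>Monomial ideals generated by variables\<close>

lemma polyring_0 [simp, intro]: "0 \<in> polyring V"
  by (simp add: polyring_def)

lemma polyring_1 [simp, intro]: "(1 :: 'k::comm_ring_1 mpoly) \<in> polyring V"
  by (simp add: polyring_def)

lemma polyring_add [intro]: "p \<in> polyring V \<Longrightarrow> q \<in> polyring V \<Longrightarrow> p + q \<in> polyring V"
  for p q :: "'k::comm_ring_1 mpoly"
  unfolding polyring_def using Poly_Mapping.keys_add[of p q] by blast

lemma polyring_uminus [intro]: "p \<in> polyring V \<Longrightarrow> - p \<in> polyring V"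
  for p :: "'k::comm_ring_1 mpoly"
  by (simp add: polyring_def in_keys_iff)

lemma polyring_diff [intro]: "p \<in> polyring V \<Longrightarrow> q \<in> polyring V \<Longrightarrow> p - q \<in> polyring V"
  for p q :: "'k::comm_ring_1 mpoly"
  using polyring_add[of p V "- q"] polyring_uminus by auto

lemma polyring_mult [intro]:
  fixes p q :: "'k::comm_ring_1 mpoly"
  assumes "p \<in> polyring V" "q \<in> polyring V"
  shows "p * q \<in> polyring V"
  unfolding polyring_def
proof (intro CollectI ballI)
  fix m assume "m \<in> Poly_Mapping.keys (p * q)"
  then obtain k l where "m = k + l" "k \<in> Poly_Mapping.keys p" "l \<in> Poly_Mapping.keys q"
    using keys_mult[of p q] by auto
  then show "Poly_Mapping.keys m \<subseteq> V"
    using assms Poly_Mapping.keys_add[of k l] by (fastforce simp: polyring_def)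
qed

lemma polyring_sum [intro]: "(\<And>i. i \<in> I \<Longrightarrow> f i \<in> polyring V) \<Longrightarrow> sum f I \<in> polyring V"
  for f :: "'i \<Rightarrow> 'k::comm_ring_1 mpoly"
  by (induction I rule: infinite_finite_induct) auto

lemma polyring_prod: "(\<And>i. i \<in> I \<Longrightarrow> f i \<in> polyring V) \<Longrightarrow> prod f I \<in> polyring V"
  for f :: "'i \<Rightarrow> 'k::comm_ring_1 mpoly"
  by (induction I rule: infinite_finite_induct) auto

lemma polyring_shsgn [intro]: "(shsgn A B :: 'k::comm_ring_1 mpoly) \<in> polyring V"
  unfolding shsgn_def by (intro polyring_prod) auto

lemma polyring_kdiff:
  fixes u :: "nat set \<Rightarrow> 'k::comm_ring_1 mpoly"
  assumes "\<And>S. u S \<in> polyring V" "\<And>i. i \<in> N \<Longrightarrow> X i \<in> polyring V"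
  shows "kdiff N X u U \<in> polyring V"
  unfolding kdiff_def contr_def
  by (simp add: assms polyring_sum polyring_mult polyring_shsgn)

definition pvar :: "vtx \<Rightarrow> 'k::comm_ring_1 mpoly" where
  "pvar v = Poly_Mapping.single (Poly_Mapping.single v 1) 1"

lemma var_mono_eq: "var_mono u v = pvar u * pvar v"
  by (simp add: var_mono_def pvar_def mult_single)

lemma polyring_pvar: "v \<in> V \<Longrightarrow> pvar v \<in> polyring V"
  by (simp add: pvar_def polyring_def)

lemma lookup_pvar_mult:
  fixes p :: "'k::comm_ring_1 mpoly"
  shows "Poly_Mapping.lookup (pvar v * p) (Poly_Mapping.single v 1 + m) = Poly_Mapping.lookup p m"
  by (simp add: lookup_mult pvar_def lookup_single when_mult)

lemma keys_single_add: "Poly_Mapping.keys (Poly_Mapping.single v 1 + m) = insert v (Poly_Mapping.keys m)"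
  for m :: "vtx \<Rightarrow>\<^sub>0 nat"
  by (auto simp: in_keys_iff lookup_add lookup_single when_def split: if_splits)

lemma single_add_diff:
  fixes m :: "vtx \<Rightarrow>\<^sub>0 nat"
  assumes "v \<in> Poly_Mapping.keys m"
  shows "m = Poly_Mapping.single v 1 + (m - Poly_Mapping.single v 1)"
  using assms
  by (intro poly_mapping_eqI) (auto simp: lookup_add lookup_minus lookup_single when_def in_keys_iff)

lemma lookup_pvar_mult_notin:
  fixes p :: "'k::comm_ring_1 mpoly"
  assumes "v \<notin> Poly_Mapping.keys m"
  shows "Poly_Mapping.lookup (pvar v * p) m = 0"
proof (rule ccontr)
  assume "Poly_Mapping.lookup (pvar v * p) m \<noteq> 0"
  then have "m \<in> Poly_Mapping.keys (pvar v * p)" by (simp add: in_keys_iff)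
  then obtain l where "m = Poly_Mapping.single v 1 + l"
    using keys_mult[of "pvar v" p] by (auto simp: pvar_def)
  then show False using assms keys_single_add by auto
qed

text \<open>Multiplication by a variable merely shifts coefficients, so a variable is a
  nonzerodivisor over any commutative ring.\<close>

lemma pvar_mult_cancel: "pvar v * p = pvar v * q \<longleftrightarrow> p = q"
  for p q :: "'k::comm_ring_1 mpoly"
  by (metis lookup_pvar_mult poly_mapping_eqI)

lemma pvar_mult_eq_0: "pvar v * p = 0 \<longleftrightarrow> p = 0"
  for p :: "'k::comm_ring_1 mpoly"
  using pvar_mult_cancel[of v p 0] by simp

text \<open>The quotient on division by the variable \<open>v\<close>: monomials without
  \<open>v\<close> are dropped, the others lose one factor \<open>v\<close>.\<close>

definition pdiv :: "vtx \<Rightarrow> 'k::comm_ring_1 mpoly \<Rightarrow> 'k mpoly" where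
  "pdiv v p = Poly_Mapping.map_key ((+) (Poly_Mapping.single v 1)) p"

lemma lookup_pdiv: "Poly_Mapping.lookup (pdiv v p) m = Poly_Mapping.lookup p (Poly_Mapping.single v 1 + m)"
  by (simp add: pdiv_def map_key.rep_eq)

lemma polyring_pdiv:
  assumes "p \<in> polyring V"
  shows "pdiv v p \<in> polyring V"
  unfolding polyring_def
proof (intro CollectI ballI)
  fix m assume "m \<in> Poly_Mapping.keys (pdiv v p)"
  then have "Poly_Mapping.single v 1 + m \<in> Poly_Mapping.keys p"
    by (simp add: in_keys_iff lookup_pdiv)
  then show "Poly_Mapping.keys m \<subseteq> V"
    using assms keys_single_add[of v m] unfolding polyring_def by blast
qed

text \<open>Membership in the ideal generated by the variables in \<open>S\<close>, read off from the monomials.\<close>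

definition touch :: "vtx set \<Rightarrow> 'k::comm_ring_1 mpoly \<Rightarrow> bool" where
  "touch S p \<longleftrightarrow> (\<forall>m\<in>Poly_Mapping.keys p. Poly_Mapping.keys m \<inter> S \<noteq> {})"

lemma touch_add: "touch S p \<Longrightarrow> touch S q \<Longrightarrow> touch S (p + q)"
  unfolding touch_def using Poly_Mapping.keys_add[of p q] by blast

lemma touch_uminus: "touch S p \<Longrightarrow> touch S (- p)"
  by (simp add: touch_def in_keys_iff)

lemma touch_sum: "(\<And>i. i \<in> I \<Longrightarrow> touch S (f i)) \<Longrightarrow> touch S (sum f I)"
  by (induction I rule: infinite_finite_induct) (auto simp: touch_add, auto simp: touch_def)

lemma touch_pvar_mult: "v \<in> S \<Longrightarrow> touch S (pvar v * p)"
  unfolding touch_def using lookup_pvar_mult_notin[of v _ p] by (fastforce simp: in_keys_iff)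

text \<open>A factor \<open>v\<close> outside \<open>S\<close> cannot bring a variable of
  \<open>S\<close> into a monomial. Hence \<open>v\<close> is a nonzerodivisor modulo the ideal
  generated by \<open>S\<close>; this is the regular sequence property behind Koszul
  exactness.\<close>

lemma touch_cancel:
  assumes "touch S (pvar v * p)" "v \<notin> S"
  shows "touch S p"
  unfolding touch_def
proof
  fix m assume "m \<in> Poly_Mapping.keys p"
  then have "Poly_Mapping.single v 1 + m \<in> Poly_Mapping.keys (pvar v * p)"
    unfolding in_keys_iff lookup_pvar_mult .
  then have "Poly_Mapping.keys (Poly_Mapping.single v 1 + m) \<inter> S \<noteq> {}"
    using assms(1) bspec unfolding touch_def by blast
  then show "Poly_Mapping.keys m \<inter> S \<noteq> {}"
    using assms(2) unfolding keys_single_add by blast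
qed

text \<open>The passage from the monomial criterion to explicit coefficients: the variables are
  split off one at a time by \<open>pdiv\<close>, which keeps the coefficients in the ring of
  \<open>V\<close>.\<close>

lemma touch_decompose:
  fixes p :: "'k::comm_ring_1 mpoly"
  assumes "finite M" "touch (vv ` M) p" "p \<in> polyring V" "vv ` M \<subseteq> V"
  shows "\<exists>g. (\<forall>i. g i \<in> polyring V) \<and> p = (\<Sum>i\<in>M. pvar (vv i) * g i)"
  using assms
proof (induction M arbitrary: p rule: finite_induct)
  case empty
  then have "p = 0" by (intro poly_mapping_eqI) (auto simp: touch_def in_keys_iff)
  then show ?case by (intro exI[of _ "\<lambda>_. 0"]) auto
next
  case (insert j M)
  define v where "v = vv j"
  \<comment> \<open>The remainder consists of exactly the monomials of \<open>p\<close> without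
    \<open>v\<close>; each of them must meet one of the remaining variables.\<close>
  define q where "q = p - pvar v * pdiv v p"
  have lq: "Poly_Mapping.lookup q m = (if v \<in> Poly_Mapping.keys m then 0 else Poly_Mapping.lookup p m)" for m
  proof (cases "v \<in> Poly_Mapping.keys m")
    case True
    then obtain l where l: "m = Poly_Mapping.single v 1 + l"
      using single_add_diff by blast
    show ?thesis using True
      unfolding q_def l lookup_minus lookup_pvar_mult lookup_pdiv by simp
  qed (simp add: q_def lookup_minus lookup_pvar_mult_notin)
  have "touch (vv ` M) q"
    unfolding touch_def
  proof
    fix m assume "m \<in> Poly_Mapping.keys q"
    then have "m \<in> Poly_Mapping.keys p" "v \<notin> Poly_Mapping.keys m"
      by (auto simp: in_keys_iff[of _ q] in_keys_iff[of _ p] lq split: if_splits)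
    then show "Poly_Mapping.keys m \<inter> vv ` M \<noteq> {}"
      using insert.prems(1) by (auto simp: touch_def v_def)
  qed
  moreover have "q \<in> polyring V"
    using insert.prems(2,3) unfolding q_def v_def
    by (intro polyring_diff polyring_mult polyring_pvar polyring_pdiv) auto
  ultimately obtain g where g: "\<forall>i. g i \<in> polyring V" "q = (\<Sum>i\<in>M. pvar (vv i) * g i)"
    using insert by auto
  have "p = pvar v * pdiv v p + q" by (simp add: q_def)
  also have "\<dots> = (\<Sum>i\<in>insert j M. pvar (vv i) * (g(j := pdiv v p)) i)"
    using insert.hyps by (simp add: g(2) v_def) (rule sum.cong, auto)
  finally show ?case
    using g(1) polyring_pdiv[OF insert.prems(2)]
    by (intro exI[of _ "g(j := pdiv v p)"] conjI) (simp, assumption)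
qed

section \<open>Exactness of the Koszul complex\<close>

lemma wedge_scalar_left:
  assumes "finite U"
  shows "wedge (\<lambda>S. if S = {} then c else 0) v U = c * v U"
proof -
  have "wedge (\<lambda>S. if S = {} then c else 0) v U = (\<Sum>S\<in>Pow U. if S = {} then c * v U else 0)"
    unfolding wedge_def by (rule sum.cong) auto
  then show ?thesis using assms by simp
qed

lemma wedge_scalar_right:
  assumes "finite U"
  shows "wedge v (\<lambda>S. if S = {} then c else 0) U = c * v U"
proof -
  have "wedge v (\<lambda>S. if S = {} then c else 0) U = (\<Sum>S\<in>Pow U. if S = U then c * v U else 0)"
    unfolding wedge_def by (rule sum.cong) (auto simp: mult.commute)
  then show ?thesis using assms by simp
qed

definition gen :: "nat \<Rightarrow> nat set \<Rightarrow> 'r::comm_ring_1" where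
  "gen j S = (if S = {j} then 1 else 0)"

lemma wedge_gen:
  assumes "finite U"
  shows "wedge (gen j) w U = (if j \<in> U then shsgn {j} (U - {j}) * w (U - {j}) else 0)"
proof -
  have "wedge (gen j) w U = (\<Sum>S\<in>Pow U. if S = {j} then shsgn {j} (U - {j}) * w (U - {j}) else 0)"
    unfolding wedge_def gen_def by (rule sum.cong) auto
  then show ?thesis using assms by (simp cong: if_cong)
qed

lemma kdiff_gen:
  assumes "finite N" "j \<in> N"
  shows "kdiff N X (gen j) = (\<lambda>U. if U = {} then X j else 0)"
proof
  fix U
  have "kdiff N X (gen j) U = (\<Sum>i\<in>N. if i = j then if U = {} then X j else 0 else 0)"
    unfolding kdiff_def contr_def gen_def by (rule sum.cong) auto
  then show "kdiff N X (gen j) U = (if U = {} then X j else 0)"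
    using assms by simp
qed

text \<open>Left multiplication by e_j is a homotopy from multiplication by \<open>X j\<close> to
  zero. This is the Leibniz rule with d e_j = \<open>X j\<close>.\<close>

lemma kdiff_wedge_gen:
  assumes "finite N" "j \<in> N" "finite U"
  shows "kdiff N X (wedge (gen j) w) U = X j * w U - wedge (gen j) (kdiff N X w) U"
proof -
  have "hom_deg 1 (gen j :: nat set \<Rightarrow> 'a)" by (auto simp: hom_deg_def gen_def)
  then show ?thesis using assms
    by (simp add: kdiff_wedge[OF assms(3), of 1] kdiff_gen wedge_scalar_left)
qed

text \<open>Every value of the differential is computed from coefficients at sets of the form
  \<open>insert i U\<close>, so the constant term never enters.\<close>

lemma kdiff_cong_nonempty:
  assumes "\<And>S. S \<noteq> {} \<Longrightarrow> u S = v S"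
  shows "kdiff N X u U = kdiff N X v U"
  unfolding kdiff_def contr_def by (rule sum.cong) (auto simp: assms)

lemma kdiff_contr:
  assumes "finite U"
  shows "kdiff N X (contr j u) U = - contr j (kdiff N X u) U"
proof -
  have "kdiff N X (contr j u) U = (\<Sum>i\<in>N. - (X i * contr j (contr i u) U))"
    unfolding kdiff_def by (rule sum.cong) (use contr_contr[OF assms, of _ j u] in auto)
  then show ?thesis
    by (simp add: kdiff_def[abs_def] contr_sum sum_negf)
qed

text \<open>Exactness in all positive degrees at once, by induction on a set \<open>M\<close> of
  indices that supports the cycle, while the differential keeps the full set \<open>N\<close>. A new
  index \<open>j\<close> is eliminated by adding to \<open>u\<close> the boundary of e_j w1, where
  w1 bounds the coefficient of e_j in \<open>u\<close>. The clause \<open>w {} = 0\<close> is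
  carried along because the induction uses it to keep the corrected cycle free of a constant
  term.\<close>

theorem koszul_exact:
  fixes u :: "nat set \<Rightarrow> 'k::comm_ring_1 mpoly"
  assumes N: "finite N" "inj_on vv N" "vv ` N \<subseteq> V"
    and M: "M \<subseteq> N"
    and "\<And>S. \<not> S \<subseteq> M \<Longrightarrow> u S = 0" "\<And>S. u S \<in> polyring V" "u {} = 0"
    and "\<And>U. kdiff N (\<lambda>i. pvar (vv i)) u U = 0"
  shows "\<exists>w. (\<forall>S. \<not> S \<subseteq> M \<longrightarrow> w S = 0) \<and> (\<forall>S. w S \<in> polyring V) \<and> w {} = 0 \<and>
           (\<forall>U. kdiff N (\<lambda>i. pvar (vv i)) w U = u U)"
proof -
  have "finite M" using N M finite_subset by auto
  then show ?thesis using assms(4-)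
  proof (induction M arbitrary: u rule: finite_induct)
    case empty
    have "u S = 0" for S using empty.prems(2,4) by (cases "S = {}") auto
    then show ?case by (intro exI[of _ "\<lambda>_. 0"]) (auto simp: kdiff_def contr_def intro!: sum.neutral)
  next
    case (insert j M)
    let ?d = "kdiff N (\<lambda>i. pvar (vv i) :: 'k mpoly)"
    have jN: "j \<in> N" and MN: "M \<subseteq> N" using insert.prems(1) by auto
    have jM: "vv j \<notin> vv ` M" using inj_onD[OF N(2)] jN MN insert.hyps by blast
    have X: "pvar (vv i) \<in> polyring V" if "i \<in> N" for i
      using that N(3) by (intro polyring_pvar) auto
    note supp = insert.prems(2) and pol = insert.prems(3) and cyc = insert.prems(5)
    \<comment> \<open>Coefficient functions are also defined on infinite sets, where the sign rules
      above do not apply; there the differential is 0 for lack of support.\<close>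
    have inf0: "?d f U = 0" if "\<And>S. infinite S \<Longrightarrow> f S = 0" "infinite U" for f U
      using that by (auto simp: kdiff_def contr_def intro!: sum.neutral)
    \<comment> \<open>The coefficient of e_j: \<open>u\<close> is e_j \<open>u1\<close> plus terms
      without \<open>j\<close>. It is again a cycle, but it may have a constant term, namely
      \<open>u {j}\<close>.\<close>
    define u1 where "u1 = contr j u"
    have u1_supp: "u1 S = 0" if "\<not> S \<subseteq> M" for S
    proof (cases "j \<in> S")
      case False
      then have "\<not> insert j S \<subseteq> insert j M" using that by auto
      then show ?thesis using supp by (simp add: u1_def contr_def)
    qed (simp add: u1_def contr_def)
    have inf_supp: "f S = 0" if "\<And>S. \<not> S \<subseteq> M \<Longrightarrow> f S = 0" "infinite S" for f :: "nat set \<Rightarrow> 'k mpoly" and S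
      using that insert.hyps(1) finite_subset by blast
    have u1_cyc: "?d u1 U = 0" for U
    proof (cases "finite U")
      case True
      then show ?thesis using cyc by (simp add: u1_def kdiff_contr contr_def)
    next
      case False
      then show ?thesis using inf0[of u1 U] inf_supp[of u1] u1_supp by blast
    qed
    have u1_pol: "u1 S \<in> polyring V" for S using pol by (auto simp: u1_def contr_def)
    \<comment> \<open>The cycle condition in degree 0 puts \<open>pvar (vv j) * u {j}\<close> into
      the ideal of the variables of \<open>M\<close>, and the factor \<open>pvar (vv j)\<close> can
      be cancelled there. So the constant term of \<open>u1\<close> is a boundary.\<close>
    have "(\<Sum>i\<in>N. pvar (vv i) * u {i}) = 0"
      using cyc[of "{}"] by (simp add: kdiff_def contr_def)
    moreover have "(\<Sum>i\<in>N. pvar (vv i) * u {i}) = (\<Sum>i\<in>insert j M. pvar (vv i) * u {i})"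
      using N(1) jN MN supp by (intro sum.mono_neutral_right) auto
    ultimately have "pvar (vv j) * u {j} = - (\<Sum>i\<in>M. pvar (vv i) * u {i})"
      using insert.hyps by (simp add: eq_neg_iff_add_eq_0)
    moreover have "touch (vv ` M) (- (\<Sum>i\<in>M. pvar (vv i) * u {i}))"
      by (intro touch_uminus touch_sum touch_pvar_mult) auto
    ultimately have "touch (vv ` M) (u {j})" using touch_cancel jM by metis
    then obtain g where g: "\<forall>i. g i \<in> polyring V" "u {j} = (\<Sum>i\<in>M. pvar (vv i) * g i)"
      using touch_decompose[of M vv "u {j}" V] insert.hyps(1) pol MN N(3) by blast
    define w0 where "w0 S = (\<Sum>i\<in>M. g i * gen i S)" for S
    have dw0: "?d w0 U = (if U = {} then u1 {} else 0)" for U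
    proof -
      have "?d w0 U = (\<Sum>i\<in>M. g i * (if U = {} then pvar (vv i) else 0))"
        unfolding w0_def kdiff_sum by (rule sum.cong) (simp_all add: kdiff_gen[OF N(1) subsetD[OF MN]])
      then show ?thesis using g(2) by (auto simp: u1_def contr_def mult.commute)
    qed
    \<comment> \<open>The constant term is accounted for by \<open>w0\<close>; what is left meets
      the hypotheses of the induction.\<close>
    define u1' where "u1' S = (if S = {} then 0 else u1 S)" for S
    have "\<And>S. \<not> S \<subseteq> M \<Longrightarrow> u1' S = 0" "\<And>S. u1' S \<in> polyring V" "u1' {} = 0"
      using u1_supp u1_pol by (auto simp: u1'_def)
    moreover have "?d u1' U = 0" for U
      using u1_cyc[of U] kdiff_cong_nonempty[of u1' u1] by (simp add: u1'_def)
    ultimately obtain w1' where w1': "\<forall>S. \<not> S \<subseteq> M \<longrightarrow> w1' S = 0" "\<forall>S. w1' S \<in> polyring V"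
      "w1' {} = 0" "\<forall>U. ?d w1' U = u1' U"
      using insert.IH[OF MN, of u1'] by blast
    define w1 where "w1 S = w0 S + w1' S" for S
    have w1: "w1 S = 0" if "\<not> S \<subseteq> M" for S
      using that w1'(1) by (auto simp: w1_def w0_def gen_def intro!: sum.neutral)
    have w1_pol: "w1 S \<in> polyring V" for S
      using g(1) w1'(2) by (auto simp: w1_def w0_def gen_def intro!: polyring_sum)
    have w1_0: "w1 {} = 0" using w1'(3) by (simp add: w1_def w0_def gen_def)
    have dw1: "?d w1 = u1"
      using w1'(4) unfolding w1_def kdiff_add dw0 by (auto simp: u1'_def)
    define e where "e = wedge (gen j) w1"
    have e: "e U = (if finite U \<and> j \<in> U then shsgn {j} (U - {j}) * w1 (U - {j}) else 0)" for U
      by (cases "finite U") (simp add: e_def wedge_gen, simp add: e_def wedge_def)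
    have e_supp: "e S = 0" if "\<not> S \<subseteq> insert j M" for S
    proof -
      have "\<not> S - {j} \<subseteq> M" using that by auto
      then show ?thesis using w1 by (simp add: e)
    qed
    \<comment> \<open>Since d e = \<open>X j\<close> \<open>w1\<close> - e_j \<open>u1\<close>,
      adding d e removes all terms of \<open>u\<close> that involve \<open>j\<close>. The sum is
      still a cycle, so the induction hypothesis applies a second time, and subtracting
      \<open>e\<close> from the resulting primitive gives one for \<open>u\<close>.\<close>
    define u' where "u' S = u S + ?d e S" for S
    have u'_supp: "u' S = 0" if S: "\<not> S \<subseteq> M" for S
    proof (cases "finite S")
      case False
      have "\<And>S. infinite S \<Longrightarrow> e S = 0" by (simp add: e)
      moreover have "u S = 0" using False insert.hyps(1) finite_subset[of S "insert j M"] supp[of S] by blast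
      ultimately show ?thesis using inf0[of e S] False by (simp add: u'_def)
    next
      case True
      have "?d e S = pvar (vv j) * w1 S - wedge (gen j) u1 S"
        unfolding e_def kdiff_wedge_gen[OF N(1) jN True] dw1 by (rule refl)
      moreover have "wedge (gen j) u1 S = u S"
      proof (cases "j \<in> S")
        case True
        then have "insert j (S - {j}) = S" by auto
        then show ?thesis using \<open>finite S\<close> True
          by (simp add: wedge_gen u1_def contr_def shsgn_square_left)
      next
        case False
        then have "\<not> S \<subseteq> insert j M" using S by auto
        then show ?thesis using False \<open>finite S\<close> supp by (simp add: wedge_gen)
      qed
      ultimately show ?thesis using w1[OF S] by (simp add: u'_def)
    qed
    have "?d u' U = 0" for U
    proof (cases "finite U")
      case True
      then show ?thesis unfolding u'_def kdiff_add using cyc N(1) by (simp add: kdiff_kdiff)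
    next
      case False
      then show ?thesis using inf0[of u' U] inf_supp[of u'] u'_supp by blast
    qed
    moreover have e_pol: "e S \<in> polyring V" for S using w1_pol by (auto simp: e)
    then have "u' S \<in> polyring V" for S
      unfolding u'_def using X pol by (intro polyring_add polyring_kdiff) auto
    moreover have "u' {} = 0"
    proof -
      have "?d e {} = pvar (vv j) * w1 {} - wedge (gen j) u1 {}"
        unfolding e_def kdiff_wedge_gen[OF N(1) jN finite.emptyI] dw1 by (rule refl)
      then show ?thesis using w1_0 insert.prems(4) by (simp add: u'_def wedge_gen)
    qed
    ultimately obtain w' where w': "\<forall>S. \<not> S \<subseteq> M \<longrightarrow> w' S = 0" "\<forall>S. w' S \<in> polyring V"
      "w' {} = 0" "\<forall>U. ?d w' U = u' U"
      using insert.IH[OF MN, of u'] u'_supp by auto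
    show ?case
    proof (intro exI[of _ "\<lambda>S. w' S + - e S"] conjI allI impI)
      fix S assume "\<not> S \<subseteq> insert j M"
      then show "w' S + - e S = 0" using w'(1) e_supp by auto
    next
      fix S show "w' S + - e S \<in> polyring V" using w'(2) e_pol by blast
    next
      show "w' {} + - e {} = 0" using w'(3) by (simp add: e)
    next
      fix U show "?d (\<lambda>S. w' S + - e S) U = u U"
        unfolding kdiff_add kdiff_uminus using w'(4) by (simp add: u'_def)
    qed
  qed
qed

section \<open>Homogeneity\<close>

lemma mdeg_add: "mdeg (k + l) = mdeg k + mdeg l"
proof -
  have "mdeg m = (\<Sum>v\<in>A. Poly_Mapping.lookup m v)" if "finite A" "Poly_Mapping.keys m \<subseteq> A" for m A
    unfolding mdeg_def using that by (intro sum.mono_neutral_left) (auto simp: in_keys_iff)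
  note * = this[of "Poly_Mapping.keys k \<union> Poly_Mapping.keys l"]
  show ?thesis
    using Poly_Mapping.keys_add[of k l] by (simp add: * lookup_add sum.distrib)
qed

lemma homogeneous_0 [simp]: "homogeneous t 0"
  by (simp add: homogeneous_def)

lemma homogeneous_sum: "(\<And>i. i \<in> I \<Longrightarrow> homogeneous t (f i)) \<Longrightarrow> homogeneous t (sum f I)"
  for f :: "'i \<Rightarrow> 'k::comm_ring_1 mpoly"
proof (induction I rule: infinite_finite_induct)
  case (insert j I)
  then show ?case
    using Poly_Mapping.keys_add[of "f j" "sum f I"] by (auto simp: homogeneous_def)
qed auto

lemma homogeneous_mult:
  fixes p q :: "'k::comm_ring_1 mpoly"
  assumes "homogeneous s p" "homogeneous t q"
  shows "homogeneous (s + t) (p * q)"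
  unfolding homogeneous_def
proof
  fix m assume "m \<in> Poly_Mapping.keys (p * q)"
  then obtain k l where "m = k + l" "k \<in> Poly_Mapping.keys p" "l \<in> Poly_Mapping.keys q"
    using keys_mult[of p q] by auto
  then show "mdeg m = s + t" using assms by (simp add: homogeneous_def mdeg_add)
qed

lemma homogeneous_one_uminus: "homogeneous 0 (1 :: 'k::comm_ring_1 mpoly)" "homogeneous 0 (- 1 :: 'k::comm_ring_1 mpoly)"
  by (auto simp: homogeneous_def in_keys_iff lookup_one mdeg_def when_def split: if_splits)

lemma homogeneous_prod: "(\<And>i. i \<in> I \<Longrightarrow> homogeneous 0 (f i)) \<Longrightarrow> homogeneous 0 (prod f I)"
  for f :: "'i \<Rightarrow> 'k::comm_ring_1 mpoly"
proof (induction I rule: infinite_finite_induct)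
  case (insert j I)
  then show ?case using homogeneous_mult[of 0 "f j" 0 "prod f I"] by simp
qed (auto simp: homogeneous_one_uminus)

lemma homogeneous_shsgn: "homogeneous 0 (shsgn A B :: 'k::comm_ring_1 mpoly)"
  unfolding shsgn_def by (intro homogeneous_prod) (simp add: homogeneous_one_uminus)

lemma homogeneous_pvar: "homogeneous 1 (pvar v :: 'k::comm_ring_1 mpoly)"
  by (simp add: homogeneous_def pvar_def mdeg_def)

text \<open>The exponent \<open>0\<close> has degree 0. Minimality of the resolution is deduced from
  this, all matrix entries being homogeneous of positive degree.\<close>

lemma homogeneous_lookup_0: "homogeneous t p \<Longrightarrow> t \<noteq> 0 \<Longrightarrow> Poly_Mapping.lookup p 0 = 0"
  unfolding homogeneous_def
  by (rule ccontr) (auto simp: mdeg_def in_keys_iff[of 0] dest: bspec[of _ _ 0])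

definition face :: "nat set \<Rightarrow> nat set \<Rightarrow> 'r::comm_ring_1" where
  "face S T = (if T = S then 1 else 0)"

lemma face_singleton: "face {s} = gen s"
  by (simp add: fun_eq_iff face_def gen_def)

lemma homogeneous_kdiff_face: "homogeneous 1 (kdiff N (\<lambda>i. pvar (vv i)) (face S) T :: 'k::comm_ring_1 mpoly)"
proof -
  have *: "homogeneous 0 (contr i (face S) T :: 'k mpoly)" for i
    by (auto simp: contr_def face_def homogeneous_shsgn)
  show ?thesis unfolding kdiff_def
    using homogeneous_mult[OF homogeneous_pvar *] by (intro homogeneous_sum) simp
qed

lemma kdiff_face_support:
  fixes X :: "nat \<Rightarrow> 'r::comm_ring_1"
  assumes "kdiff N X (face S) T \<noteq> 0" "finite S"
  shows "T \<subseteq> S" "card S = Suc (card T)"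
proof -
  obtain i where "contr i (face S) T \<noteq> (0 :: 'r)"
    using assms(1) by (fastforce simp: kdiff_def intro: sum.neutral)
  then have i: "i \<notin> T" "insert i T = S"
    by (auto simp: contr_def face_def split: if_splits)
  then show "T \<subseteq> S" "card S = Suc (card T)" using assms(2) by auto
qed

lemma wedge_nonzero:
  assumes "wedge u v U \<noteq> 0"
  obtains S where "finite U" "S \<subseteq> U" "u S \<noteq> 0" "v (U - S) \<noteq> 0"
proof -
  have "finite U" using assms by (auto simp: wedge_def intro: ccontr)
  moreover obtain S where "S \<in> Pow U" "shsgn S (U - S) * u S * v (U - S) \<noteq> 0"
    using assms unfolding wedge_def by (meson sum.neutral)
  ultimately show ?thesis using that[of S] by (metis PowD mult_zero_left mult_zero_right)
qed

lemma hom_deg_wedge: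
  assumes "hom_deg i u" "hom_deg j v"
  shows "hom_deg (i + j) (wedge u v)"
  unfolding hom_deg_def
proof (intro allI impI)
  fix U assume "wedge u v U \<noteq> 0"
  then obtain S where S: "finite U" "S \<subseteq> U" "u S \<noteq> 0" "v (U - S) \<noteq> 0" by (rule wedge_nonzero)
  then have "card S = i" "card (U - S) = j" using assms by (auto simp: hom_deg_def)
  moreover have "card U = card S + card (U - S)"
    using S(1,2) by (metis card_Diff_subset card_mono finite_subset le_add_diff_inverse)
  ultimately show "card U = i + j" by simp
qed

section \<open>The resolution inside a product of two Koszul algebras\<close>

locale Lgraph =
  fixes a b c :: nat
begin

abbreviation V :: "vtx set" where "V \<equiv> Lverts a b c"

text \<open>The set \<open>N \<beta>\<close> indexes the neighbours of the vertex
  \<open>twv \<beta>\<close>: 0 is the other end of the edge xy, the indices from 1 to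
  \<open>lv \<beta>\<close> are the leaves, and the last \<open>c\<close> indices are the common
  neighbours z_k.\<close>

definition lv :: "bool \<Rightarrow> nat" where "lv \<beta> = (if \<beta> then b else a)"
definition nv :: "bool \<Rightarrow> nat" where "nv \<beta> = lv \<beta> + c"
definition N :: "bool \<Rightarrow> nat set" where "N \<beta> = {..nv \<beta>}"
definition twv :: "bool \<Rightarrow> vtx" where "twv \<beta> = (if \<beta> then VY else VX)"
definition vv :: "bool \<Rightarrow> nat \<Rightarrow> vtx" where
  "vv \<beta> i = (if i = 0 then twv (\<not> \<beta>) else if i \<le> lv \<beta> then (if \<beta> then VYj i else VXi i)
     else VZk (i - lv \<beta>))"

abbreviation tw :: "bool \<Rightarrow> 'k::comm_ring_1 mpoly" where "tw \<beta> \<equiv> pvar (twv \<beta>)"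
abbreviation X :: "bool \<Rightarrow> nat \<Rightarrow> 'k::comm_ring_1 mpoly" where "X \<beta> \<equiv> \<lambda>i. pvar (vv \<beta> i)"

lemma finite_N [simp]: "finite (N \<beta>)" by (simp add: N_def)

lemma zero_in_N [simp]: "0 \<in> N \<beta>" by (simp add: N_def)

lemma N_eq: "N \<beta> = insert 0 {1..nv \<beta>}" by (auto simp: N_def)

lemma vv_0: "vv \<beta> 0 = twv (\<not> \<beta>)" by (simp add: vv_def)

lemma inj_vv: "inj_on (vv \<beta>) (N \<beta>)"
  by (auto simp: inj_on_def vv_def twv_def split: if_splits)

lemma twv_V: "twv \<beta> \<in> V" by (simp add: twv_def Lverts_def)

lemma vv_V: "vv \<beta> ` N \<beta> \<subseteq> V"
proof
  fix v assume "v \<in> vv \<beta> ` N \<beta>"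
  then obtain i where i: "i \<le> lv \<beta> + c" "v = vv \<beta> i" by (auto simp: N_def nv_def)
  show "v \<in> V"
  proof (cases "i \<le> lv \<beta>")
    case False
    then have "v = VZk (i - lv \<beta>)" "i - lv \<beta> \<in> {1..c}" using i by (auto simp: vv_def)
    then show ?thesis by (auto simp: Lverts_def)
  qed (use i in \<open>auto simp: vv_def Lverts_def twv_def lv_def split: if_splits\<close>)
qed

lemma twv_not: "twv (\<not> \<beta>) \<noteq> twv \<beta>" by (auto simp: twv_def)

lemma polyring_tw [simp, intro]: "tw \<beta> \<in> polyring V"
  by (rule polyring_pvar[OF twv_V])

lemma polyring_X: "i \<in> N \<beta> \<Longrightarrow> X \<beta> i \<in> polyring V"
  using vv_V by (intro polyring_pvar) auto

text \<open>Faces of the two simplices. The empty face and the vertex of xy belong to both simplices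
  and are listed once, on side \<open>False\<close>; all larger faces belong to one side
  only.\<close>

definition Bas :: "nat \<Rightarrow> (bool \<times> nat set) set" where
  "Bas i = (if i = 0 then {(False, {})}
     else if i = 1 then insert (False, {0}) {(\<beta>, {s}) | \<beta> s. s \<in> {1..nv \<beta>}}
     else {(\<beta>, S). S \<subseteq> N \<beta> \<and> card S = i})"

lemma finite_Bas: "finite (Bas i)"
proof -
  have "Bas i \<subseteq> (SIGMA \<beta>:UNIV. Pow (N \<beta>))" by (auto simp: Bas_def N_def split: if_splits)
  then show ?thesis by (rule finite_subset) (simp add: finite_SigmaI)
qed

definition rk :: "nat \<Rightarrow> nat" where "rk i = card (Bas i)"

text \<open>A free module is given by its rank alone, so the faces have to be numbered; any
  bijection will do.\<close>

definition en :: "nat \<Rightarrow> nat \<Rightarrow> bool \<times> nat set" where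
  "en i = (SOME f. bij_betw f {..<rk i} (Bas i))"

definition idx :: "nat \<Rightarrow> bool \<times> nat set \<Rightarrow> nat" where
  "idx i = inv_into {..<rk i} (en i)"

lemma bij_en: "bij_betw (en i) {..<rk i} (Bas i)"
proof -
  have "\<exists>f. bij_betw f {..<rk i} (Bas i)"
    using ex_bij_betw_nat_finite[OF finite_Bas[of i]] by (simp add: rk_def atLeast0LessThan)
  then show ?thesis unfolding en_def by (rule someI_ex)
qed

lemma en_Bas: "p < rk i \<Longrightarrow> en i p \<in> Bas i"
  using bij_en[of i] by (auto simp: bij_betw_def)

lemma idx_less: "B \<in> Bas i \<Longrightarrow> idx i B < rk i"
  unfolding idx_def using bij_en[of i] by (metis bij_betw_def inv_into_into lessThan_iff)

lemma en_idx: "B \<in> Bas i \<Longrightarrow> en i (idx i B) = B"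
  unfolding idx_def using bij_en[of i] by (metis bij_betw_def f_inv_into_f)

lemma idx_en: "p < rk i \<Longrightarrow> idx i (en i p) = p"
  unfolding idx_def using bij_en[of i] by (auto simp: bij_betw_def)

lemma idx_eq_iff: "p < rk i \<Longrightarrow> B \<in> Bas i \<Longrightarrow> idx i B = p \<longleftrightarrow> en i p = B"
  by (metis en_idx idx_en)

lemma rk_0: "rk 0 = 1" by (simp add: rk_def Bas_def)

lemma Bas_0: "(False, {}) \<in> Bas 0" by (simp add: Bas_def)

lemma idx_0: "idx 0 (False, {}) = 0"
  using idx_less[OF Bas_0] by (simp add: rk_0)

lemma Bas_1_zero: "(False, {0}) \<in> Bas 1" by (simp add: Bas_def)

lemma Bas_1: "s \<in> {1..nv \<beta>} \<Longrightarrow> (\<beta>, {s}) \<in> Bas 1" by (simp add: Bas_def)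

lemma Bas_ge2: "2 \<le> i \<Longrightarrow> (\<beta>, S) \<in> Bas i \<longleftrightarrow> S \<subseteq> N \<beta> \<and> card S = i"
  by (simp add: Bas_def)

text \<open>Side \<open>False\<close> is \<open>K\<close> and side \<open>True\<close> is \<open>L\<close>; \<open>e\<^sub>0\<close> is the generator with index 0. Elements
  of the resolution are given by their coordinates in the basis \<open>Bas i\<close>, enumerated by \<open>en i\<close>.\<close>

definition emb :: "nat \<Rightarrow> (nat \<Rightarrow> 'k::comm_ring_1 mpoly) \<Rightarrow> bool \<Rightarrow> nat set \<Rightarrow> 'k mpoly" where
  "emb i v \<beta> U = (if \<not> (U \<subseteq> N \<beta> \<and> card U = i) then 0
     else if i = 0 then v (idx 0 (False, {}))
     else if U = {0} then tw \<beta> * v (idx 1 (False, {0}))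
       + (\<Sum>s\<in>{1..nv (\<not> \<beta>)}. X (\<not> \<beta>) s * v (idx 1 (\<not> \<beta>, {s})))
     else tw \<beta> * v (idx i (\<beta>, U)))"

lemma emb_zero: "emb i (\<lambda>_. 0) \<beta> U = 0"
  by (simp add: emb_def)

lemma emb_scale: "emb i (\<lambda>p. t * f p) \<beta> U = t * emb i f \<beta> U"
  by (simp add: emb_def sum_distrib_left algebra_simps)

lemma emb_add: "emb i (\<lambda>p. f p + g p) \<beta> U = emb i f \<beta> U + emb i g \<beta> U"
  by (simp add: emb_def sum.distrib algebra_simps)

lemma emb_sum: "emb i (\<lambda>p. \<Sum>q\<in>I. t q * f q p) \<beta> U = (\<Sum>q\<in>I. t q * emb i (f q) \<beta> U)"
  by (induction I rule: infinite_finite_induct) (simp_all add: emb_zero emb_add emb_scale)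

lemma emb_support: "\<not> U \<subseteq> N \<beta> \<Longrightarrow> emb i v \<beta> U = 0"
  by (simp add: emb_def)

lemma emb_infinite: "infinite U \<Longrightarrow> emb i v \<beta> U = 0"
  using finite_subset[OF _ finite_N] by (intro emb_support) auto

lemma hom_deg_emb: "hom_deg i (emb i v \<beta>)"
  by (simp add: hom_deg_def emb_def)

lemma fmodD: "v \<in> fmod W r i \<Longrightarrow> v p \<in> polyring W" "v \<in> fmod W r i \<Longrightarrow> r i \<le> p \<Longrightarrow> v p = 0"
  by (auto simp: fmod_def)

lemma emb_polyring:
  assumes "v \<in> fmod V rk i"
  shows "emb i v \<beta> U \<in> polyring V"
  unfolding emb_def using fmodD(1)[OF assms]
  by (auto simp: N_def intro!: polyring_add polyring_mult polyring_sum polyring_X)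

lemma emb_deg0: "emb 0 v \<beta> = (\<lambda>U. if U = {} then v 0 else 0)"
proof
  fix U
  have "U \<subseteq> N \<beta> \<and> card U = 0 \<longleftrightarrow> U = {}" using finite_subset[of U "N \<beta>"] by auto
  then show "emb 0 v \<beta> U = (if U = {} then v 0 else 0)" by (simp add: emb_def idx_0)
qed

lemma emb_deg1_pos: "s \<in> {1..nv \<beta>} \<Longrightarrow> emb 1 v \<beta> {s} = tw \<beta> * v (idx 1 (\<beta>, {s}))"
  by (auto simp: emb_def N_def)

lemma emb_deg1_zero: "emb 1 v \<beta> {0} = tw \<beta> * v (idx 1 (False, {0}))
       + (\<Sum>s\<in>{1..nv (\<not> \<beta>)}. X (\<not> \<beta>) s * v (idx 1 (\<not> \<beta>, {s})))"
  by (simp add: emb_def)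

lemma emb_ge2: "2 \<le> i \<Longrightarrow> emb i v \<beta> U = (if U \<subseteq> N \<beta> \<and> card U = i then tw \<beta> * v (idx i (\<beta>, U)) else 0)"
  by (auto simp: emb_def)

text \<open>Injectivity is what carries identities from the Koszul algebras back to the resolution.
  In degree 1 the coordinates other than that of xy are read off at \<open>{s}\<close> with s > 0;
  once they vanish, the value at \<open>{0}\<close> is a variable times the coordinate of
  xy.\<close>

lemma emb_inj_zero:
  assumes "v \<in> fmod V rk i" "\<And>\<beta> U. emb i v \<beta> U = 0"
  shows "v = (\<lambda>_. 0)"
proof
  fix p
  show "v p = 0"
  proof (cases "p < rk i")
    case False
    then show ?thesis using fmodD(2)[OF assms(1)] by simp
  next
    case True
    obtain \<beta> S where B: "en i p = (\<beta>, S)" by fastforce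
    have BB: "(\<beta>, S) \<in> Bas i" and p: "idx i (\<beta>, S) = p"
      using en_Bas[OF True] idx_en[OF True] B by auto
    consider "i = 0" | "i = 1" | "2 \<le> i" by linarith
    then show ?thesis
    proof cases
      case 1
      then show ?thesis using assms(2)[of False "{}"] True by (simp add: emb_deg0 rk_0)
    next
      case 2
      have pos: "v (idx 1 (\<gamma>, {s})) = 0" if "s \<in> {1..nv \<gamma>}" for \<gamma> s
        using assms(2)[of \<gamma> "{s}"] emb_deg1_pos[OF that] 2 pvar_mult_eq_0 by metis
      then have "v (idx 1 (False, {0})) = 0"
        using assms(2)[of False "{0}"] unfolding 2 emb_deg1_zero by (simp add: pvar_mult_eq_0)
      then show ?thesis using pos BB p 2 by (auto simp: Bas_def)
    next
      case 3
      then show ?thesis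
        using assms(2)[of \<beta> S] BB p by (simp add: emb_ge2 Bas_ge2 pvar_mult_eq_0)
    qed
  qed
qed

lemma emb_inj:
  assumes "v \<in> fmod V rk i" "w \<in> fmod V rk i" "\<And>\<beta> U. emb i v \<beta> U = emb i w \<beta> U"
  shows "v = w"
proof -
  have "(\<lambda>p. v p + (- 1) * w p) = (\<lambda>_. 0)"
  proof (rule emb_inj_zero)
    show "(\<lambda>p. v p + (- 1) * w p) \<in> fmod V rk i"
      using assms(1,2) by (auto simp: fmod_def)
  qed (simp only: emb_add emb_scale assms(3), simp)
  then show ?thesis by (auto simp: fun_eq_iff)
qed

text \<open>From degree 2 on the two sides share no basis element, so the coordinates can be
  prescribed independently on each side.\<close>

lemma emb_surj:
  assumes "2 \<le> i" "\<And>\<beta> S. u \<beta> S \<in> polyring V"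
  obtains v where "v \<in> fmod V rk i"
    "\<And>\<beta> U. emb i v \<beta> U = (if U \<subseteq> N \<beta> \<and> card U = i then tw \<beta> * u \<beta> U else 0)"
proof
  let ?v = "\<lambda>p. if p < rk i then u (fst (en i p)) (snd (en i p)) else 0"
  show "?v \<in> fmod V rk i" using assms(2) by (simp add: fmod_def)
  fix \<beta> U
  show "emb i ?v \<beta> U = (if U \<subseteq> N \<beta> \<and> card U = i then tw \<beta> * u \<beta> U else 0)"
    using idx_less[of "(\<beta>, U)" i] en_idx[of "(\<beta>, U)" i] Bas_ge2[OF assms(1), of \<beta> U]
    by (simp add: emb_ge2[OF assms(1)])
qed

definition unitv :: "nat \<Rightarrow> nat \<Rightarrow> 'k::comm_ring_1 mpoly" where
  "unitv q p = (if p = q then 1 else 0)"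

lemma unitv_fmod: "q < rk i \<Longrightarrow> unitv q \<in> fmod V rk i"
  by (auto simp: fmod_def unitv_def)

lemma fmod_expand:
  assumes "v \<in> fmod V rk i"
  shows "v = (\<lambda>p. \<Sum>q<rk i. v q * unitv q p)"
proof
  fix p
  have "(\<Sum>q<rk i. v q * unitv q p) = (\<Sum>q<rk i. if p = q then v q else 0)"
    by (rule sum.cong) (auto simp: unitv_def)
  then show "v p = (\<Sum>q<rk i. v q * unitv q p)"
    using fmodD(2)[OF assms, of p] by simp
qed

lemma emb_expand:
  assumes "v \<in> fmod V rk i"
  shows "emb i v \<beta> = (\<lambda>U. \<Sum>q<rk i. v q * emb i (unitv q) \<beta> U)"
  by (subst fmod_expand[OF assms]) (simp add: fun_eq_iff emb_sum)

section \<open>The differential of the resolution\<close>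

context
  notes One_nat_def [simp del]
begin

definition K :: "bool \<Rightarrow> nat set \<Rightarrow> nat set \<Rightarrow> 'k::comm_ring_1 mpoly" where
  "K \<beta> S = kdiff (N \<beta>) (X \<beta>) (face S)"

text \<open>In positive degrees a face is embedded on its own side with the factor
  \<open>tw \<beta>\<close>, so the Koszul coefficients themselves serve as entries; in degree 0
  there is no such factor, so \<open>tw \<beta>\<close> appears in the first matrix. The alternative
  \<open>T = {0}\<close> admits the row of xy, listed on side \<open>False\<close>, for faces of
  either side. It can only occur for \<open>i = 2\<close>.\<close>

definition dmat :: "nat \<Rightarrow> nat \<Rightarrow> nat \<Rightarrow> 'k::comm_ring_1 mpoly" where
  "dmat i p q = (if i = 0 \<or> rk (i - 1) \<le> p \<or> rk i \<le> q then 0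
     else case en i q of (\<beta>, S) \<Rightarrow>
       if i = 1 then tw \<beta> * K \<beta> S {}
       else case en (i - 1) p of (\<gamma>, T) \<Rightarrow> if \<gamma> = \<beta> \<or> T = {0} then K \<beta> S T else 0)"

lemma polyring_K: "(K \<beta> S T :: 'k::comm_ring_1 mpoly) \<in> polyring V"
  unfolding K_def by (rule polyring_kdiff) (auto simp: face_def polyring_X)

lemma polyring_dmat: "(dmat i p q :: 'k::comm_ring_1 mpoly) \<in> polyring V"
  by (auto simp: dmat_def polyring_K intro!: polyring_mult split: prod.split)

lemma homogeneous_dmat:
  "homogeneous (if i = 1 then 2 else 1) (dmat i p q :: 'k::comm_ring_1 mpoly)"
proof -
  have h: "homogeneous 1 (K \<beta> S T :: 'k mpoly)" for \<beta> S T
    unfolding K_def by (rule homogeneous_kdiff_face)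
  then have "homogeneous 2 (tw \<beta> * K \<beta> S T :: 'k mpoly)" for \<beta> S T
    using homogeneous_mult[OF homogeneous_pvar h] by (simp add: numeral_2_eq_2)
  with h show ?thesis by (auto simp: dmat_def split: prod.split)
qed

lemma K_singleton: "s \<in> N \<beta> \<Longrightarrow> K \<beta> {s} U = (if U = {} then X \<beta> s else 0)"
  by (simp add: K_def face_singleton kdiff_gen)

text \<open>The identity d d e_S = 0 read at the empty set. It makes the boundary of a face with two
  vertices invisible on the opposite side.\<close>

lemma K_boundary: "(\<Sum>t\<in>N \<beta>. X \<beta> t * K \<beta> S {t}) = 0"
proof -
  have "(\<Sum>t\<in>N \<beta>. X \<beta> t * K \<beta> S {t}) = kdiff (N \<beta>) (X \<beta>) (K \<beta> S) {}"
    by (simp add: kdiff_def[where u = "K \<beta> S"] contr_def)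
  also have "\<dots> = 0" unfolding K_def by (simp add: kdiff_kdiff)
  finally show ?thesis .
qed

lemma emb_unitv_ge2:
  assumes "2 \<le> i" "q < rk i" "en i q = (\<gamma>, S)"
  shows "emb i (unitv q) \<beta> = (\<lambda>U. (if \<beta> = \<gamma> then tw \<beta> else 0) * face S U)"
proof
  fix U
  have "(\<gamma>, S) \<in> Bas i" using en_Bas[OF assms(2)] assms(3) by simp
  then have "S \<subseteq> N \<gamma> \<and> card S = i" using Bas_ge2[OF assms(1)] by blast
  then show "emb i (unitv q) \<beta> U = (if \<beta> = \<gamma> then tw \<beta> else 0) * face S U"
    using idx_eq_iff[OF assms(2), of "(\<beta>, U)"] Bas_ge2[OF assms(1), of \<beta> U] assms(3)
    by (auto simp: emb_ge2[OF assms(1)] unitv_def face_def)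
qed

lemma emb_deg1_other: "(\<And>s. s \<in> N \<beta> \<Longrightarrow> U \<noteq> {s}) \<Longrightarrow> emb 1 v \<beta> U = 0"
  unfolding emb_def by (metis card_1_singletonE insert_subset)

lemma emb_unitv_1_zero:
  assumes "q < rk 1" "en 1 q = (False, {0})"
  shows "emb 1 (unitv q :: nat \<Rightarrow> 'k::comm_ring_1 mpoly) \<beta> = (\<lambda>U. tw \<beta> * face {0} U)"
proof
  fix U
  have z: "unitv q (idx 1 (\<gamma>, {s})) = (0 :: 'k mpoly)" if "s \<in> {1..nv \<gamma>}" for \<gamma> s
    using idx_eq_iff[OF assms(1) Bas_1[OF that]] assms(2) that by (auto simp: unitv_def)
  have o: "unitv q (idx 1 (False, {0})) = (1 :: 'k mpoly)"
    using idx_eq_iff[OF assms(1) Bas_1_zero] assms(2) by (auto simp: unitv_def)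
  consider "U = {0}" | s where "s \<in> {1..nv \<beta>}" "U = {s}" | "\<And>s. s \<in> N \<beta> \<Longrightarrow> U \<noteq> {s}"
    unfolding N_eq by blast
  then show "emb 1 (unitv q :: nat \<Rightarrow> 'k mpoly) \<beta> U = tw \<beta> * face {0} U"
  proof cases
    case 1
    show ?thesis unfolding 1 emb_deg1_zero o using z by (simp add: face_def)
  next
    case 2
    then show ?thesis unfolding 2(2) emb_deg1_pos[OF 2(1)] z[OF 2(1)] by (simp add: face_def)
  next
    case 3
    then show ?thesis using emb_deg1_other[OF 3, where v = "unitv q"] zero_in_N by (auto simp: face_def)
  qed
qed

lemma emb_unitv_1_pos:
  assumes "q < rk 1" "en 1 q = (\<gamma>, {s})" "s \<in> {1..nv \<gamma>}"
  shows "emb 1 (unitv q :: nat \<Rightarrow> 'k::comm_ring_1 mpoly) \<beta> = (\<lambda>U. if \<beta> = \<gamma> then tw \<beta> * face {s} U else X \<gamma> s * face {0} U)"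
proof
  fix U
  have z: "unitv q (idx 1 (\<delta>, {t})) = (if \<delta> = \<gamma> \<and> t = s then 1 else 0 :: 'k mpoly)"
    if "t \<in> {1..nv \<delta>}" for \<delta> t
    using idx_eq_iff[OF assms(1) Bas_1[OF that]] assms(2) that by (auto simp: unitv_def)
  have o: "unitv q (idx 1 (False, {0})) = (0 :: 'k mpoly)"
    using idx_eq_iff[OF assms(1) Bas_1_zero] assms(2,3) by (auto simp: unitv_def)
  consider "U = {0}" | t where "t \<in> {1..nv \<beta>}" "U = {t}" | "\<And>s. s \<in> N \<beta> \<Longrightarrow> U \<noteq> {s}"
    unfolding N_eq by blast
  then show "emb 1 (unitv q :: nat \<Rightarrow> 'k mpoly) \<beta> U = (if \<beta> = \<gamma> then tw \<beta> * face {s} U else X \<gamma> s * face {0} U)"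
  proof cases
    case 1
    have "(\<Sum>t\<in>{1..nv (\<not> \<beta>)}. X (\<not> \<beta>) t * unitv q (idx 1 (\<not> \<beta>, {t})))
        = (\<Sum>t\<in>{1..nv (\<not> \<beta>)}. if t = s then if \<beta> = \<gamma> then 0 else X \<gamma> s else 0 :: 'k mpoly)"
      by (rule sum.cong) (auto simp: z)
    also have "\<dots> = (if \<beta> = \<gamma> then 0 else X \<gamma> s)"
      using assms(3) by (cases \<beta>; cases \<gamma>) auto
    finally show ?thesis unfolding 1 emb_deg1_zero o using assms(3) by (simp add: face_def)
  next
    case 2
    then show ?thesis unfolding 2(2) emb_deg1_pos[OF 2(1)] z[OF 2(1)] using 2(1) by (auto simp: face_def)
  next
    case 3
    have "U \<noteq> {0}" "\<beta> = \<gamma> \<Longrightarrow> U \<noteq> {s}" using 3 assms(3) by (auto simp: N_def)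
    then show ?thesis using emb_deg1_other[OF 3, where v = "unitv q"] by (auto simp: face_def)
  qed
qed

lemma Bas_1_cases:
  assumes "B \<in> Bas 1"
  obtains "B = (False, {0})" | \<gamma> s where "B = (\<gamma>, {s})" "s \<in> {1..nv \<gamma>}"
  using assms by (auto simp: Bas_def)

lemma kdiff_face_scale: "kdiff (N \<beta>) (X \<beta>) (\<lambda>U. t * face S U) U = t * K \<beta> S U"
  by (simp add: kdiff_scale K_def)

lemma emb_dmat_1:
  assumes "q < rk 1"
  shows "emb 0 (\<lambda>p. dmat 1 p q) \<beta> U = kdiff (N \<beta>) (X \<beta>) (emb 1 (unitv q :: nat \<Rightarrow> 'k::comm_ring_1 mpoly) \<beta>) U"
proof (cases rule: Bas_1_cases[OF en_Bas[OF assms]])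
  case 1
  have "dmat 1 0 q = (tw False * X False 0 :: 'k mpoly)"
    using assms 1 by (simp add: dmat_def rk_0 K_singleton)
  also have "\<dots> = tw \<beta> * X \<beta> 0"
    by (cases \<beta>) (simp_all add: vv_0 mult.commute)
  finally have d: "dmat 1 0 q = (tw \<beta> * X \<beta> 0 :: 'k mpoly)" .
  show ?thesis
    unfolding emb_unitv_1_zero[OF assms 1] kdiff_face_scale emb_deg0 d by (simp add: K_singleton)
next
  case (2 \<gamma> s)
  have s: "s \<in> N \<gamma>" using 2(2) by (simp add: N_def)
  have d: "dmat 1 0 q = (tw \<gamma> * X \<gamma> s :: 'k mpoly)"
    using assms 2 s by (simp add: dmat_def rk_0 K_singleton)
  show ?thesis
  proof (cases "\<beta> = \<gamma>")
    case True
    then have e: "emb 1 (unitv q :: nat \<Rightarrow> 'k mpoly) \<beta> = (\<lambda>U. tw \<beta> * face {s} U)"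
      using emb_unitv_1_pos[OF assms 2, of \<beta>, where 'k = 'k] by simp
    show ?thesis unfolding e kdiff_face_scale using True s d by (simp add: emb_deg0 K_singleton)
  next
    case False
    then have e: "emb 1 (unitv q :: nat \<Rightarrow> 'k mpoly) \<beta> = (\<lambda>U. X \<gamma> s * face {0} U)"
      using emb_unitv_1_pos[OF assms 2, of \<beta>, where 'k = 'k] by simp
    \<comment> \<open>On the side opposite to the edge, its image is a multiple of e_0, and d e_0
      there is the variable \<open>tw \<gamma>\<close>. Both sides thus produce the same edge
      monomial.\<close>
    have "twv (\<not> \<beta>) = twv \<gamma>" using False by (cases \<beta>; cases \<gamma>) auto
    then show ?thesis unfolding e kdiff_face_scale using d
      by (simp add: emb_deg0 K_singleton vv_0 mult.commute)
  qed
qed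

text \<open>The embedding is a chain map. Beyond \<open>i = 2\<close> this is an entrywise
  comparison; at \<open>i = 2\<close> the coefficient of e_0 collects contributions from several
  edges and needs care.\<close>

lemma emb_dmat_ge2:
  assumes i: "2 \<le> i" and q: "q < rk i"
  shows "emb (i - 1) (\<lambda>p. dmat i p q) \<beta> U = kdiff (N \<beta>) (X \<beta>) (emb i (unitv q :: nat \<Rightarrow> 'k::comm_ring_1 mpoly) \<beta>) U"
proof -
  obtain \<gamma> S where B: "en i q = (\<gamma>, S)" by fastforce
  then have S: "S \<subseteq> N \<gamma>" "card S = i" using en_Bas[OF q] Bas_ge2[OF i] by auto
  then have fS: "finite S" using finite_subset finite_N by blast
  have D: "dmat i (idx (i - 1) (\<delta>, T)) q = (if \<delta> = \<gamma> \<or> T = {0} then K \<gamma> S T else 0 :: 'k mpoly)"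
    if "(\<delta>, T) \<in> Bas (i - 1)" for \<delta> T
    using i q that idx_less[OF that] en_idx[OF that] B by (simp add: dmat_def)
  have rhs: "kdiff (N \<beta>) (X \<beta>) (emb i (unitv q) \<beta>) U = (if \<beta> = \<gamma> then tw \<beta> else 0 :: 'k mpoly) * K \<beta> S U"
    unfolding emb_unitv_ge2[OF i q B] kdiff_face_scale ..
  show ?thesis
  proof (cases "U \<subseteq> N \<beta> \<and> card U = i - 1")
    case False
    then have "emb (i - 1) (\<lambda>p. dmat i p q) \<beta> U = (0 :: 'k mpoly)" by (simp add: emb_def)
    moreover have "K \<beta> S U = (0 :: 'k mpoly)" if "\<beta> = \<gamma>"
    proof (rule ccontr)
      assume "K \<beta> S U \<noteq> (0 :: 'k mpoly)"
      note kdiff_face_support[OF this[unfolded K_def] fS]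
      then show False using False S that by auto
    qed
    ultimately show ?thesis unfolding rhs by simp
  next
    case True
    show ?thesis
    proof (cases "i = 2")
      case False
      then have "2 \<le> i - 1" using i by simp
      moreover have "U \<noteq> {0}" using True \<open>2 \<le> i - 1\<close> by auto
      ultimately show ?thesis unfolding rhs using True D[of \<beta> U]
        by (simp add: emb_ge2 Bas_ge2)
    next
      case i2: True
      then have i1: "i - 1 = 1" by simp
      obtain t where t: "U = {t}" "t \<in> N \<beta>"
        using True i1 by (auto elim: card_1_singletonE)
      show ?thesis
      proof (cases "t = 0")
        case False
        then have t1: "t \<in> {1..nv \<beta>}" using t(2) by (simp add: N_def)
        have "dmat i (idx 1 (\<beta>, {t})) q = (if \<beta> = \<gamma> then K \<gamma> S {t} else 0 :: 'k mpoly)"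
          using D[unfolded i1, OF Bas_1[OF t1]] False by simp
        then show ?thesis unfolding rhs unfolding t(1) i1 emb_deg1_pos[OF t1] by simp
      next
        case t0: True
        have d0: "dmat i (idx 1 (False, {0})) q = (K \<gamma> S {0} :: 'k mpoly)"
          using D[unfolded i1, OF Bas_1_zero] by simp
        have ds: "dmat i (idx 1 (\<not> \<beta>, {s})) q = (if \<beta> = \<gamma> then 0 else K \<gamma> S {s} :: 'k mpoly)"
          if "s \<in> {1..nv (\<not> \<beta>)}" for s
          using D[unfolded i1, OF Bas_1[OF that]] that by auto
        show ?thesis
        proof (cases "\<beta> = \<gamma>")
          case True
          then show ?thesis unfolding rhs unfolding t(1) t0 i1 emb_deg1_zero d0 using ds by simp
        next
          case False
          then have g: "\<gamma> = (\<not> \<beta>)" by auto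
          \<comment> \<open>The face lives on the side \<open>\<gamma>\<close> opposite to
            \<open>\<beta>\<close>, where its image is 0. As \<open>tw \<beta>\<close> is the
            variable of index 0 on side \<open>\<gamma>\<close>, the collected terms are precisely
            the sum in \<open>K_boundary\<close>.\<close>
          have "emb 1 (\<lambda>p. dmat i p q) \<beta> {0}
              = (tw \<beta> :: 'k mpoly) * K \<gamma> S {0} + (\<Sum>s\<in>{1..nv \<gamma>}. X \<gamma> s * K \<gamma> S {s})"
            unfolding emb_deg1_zero d0 using ds False by (simp add: g)
          also have "\<dots> = (\<Sum>s\<in>N \<gamma>. X \<gamma> s * K \<gamma> S {s})"
            by (simp add: N_eq vv_0 g)
          also have "\<dots> = 0" by (rule K_boundary)
          finally show ?thesis unfolding rhs unfolding t(1) t0 i1 using False by simp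
        qed
      qed
    qed
  qed
qed

lemma emb_dmat:
  assumes "1 \<le> i" "q < rk i"
  shows "emb (i - 1) (\<lambda>p. dmat i p q) \<beta> U = kdiff (N \<beta>) (X \<beta>) (emb i (unitv q) \<beta>) U"
  using assms emb_dmat_1[of q] emb_dmat_ge2[of i q] by (cases "i = 1") auto

lemma diff_fmod:
  assumes "v \<in> fmod V rk i"
  shows "diff dmat rk i v \<in> fmod V rk (i - 1)"
  using assms by (auto simp: fmod_def diff_def polyring_dmat intro!: polyring_sum polyring_mult)

lemma emb_diff:
  assumes "1 \<le> i" "v \<in> fmod V rk i"
  shows "emb (i - 1) (diff dmat rk i v) \<beta> U = kdiff (N \<beta>) (X \<beta>) (emb i v \<beta>) U"
proof -
  have "diff dmat rk i v = (\<lambda>p. \<Sum>q<rk i. v q * dmat i p q)"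
  proof
    fix p
    show "diff dmat rk i v p = (\<Sum>q<rk i. v q * dmat i p q)"
      using assms(1) by (auto simp: diff_def mult.commute dmat_def)
  qed
  then have "emb (i - 1) (diff dmat rk i v) \<beta> U = (\<Sum>q<rk i. v q * emb (i - 1) (\<lambda>p. dmat i p q) \<beta> U)"
    by (simp add: emb_sum)
  also have "\<dots> = (\<Sum>q<rk i. v q * kdiff (N \<beta>) (X \<beta>) (emb i (unitv q) \<beta>) U)"
    by (intro sum.cong refl) (simp only: emb_dmat[OF assms(1)] lessThan_iff)
  also have "\<dots> = kdiff (N \<beta>) (X \<beta>) (emb i v \<beta>) U"
    unfolding emb_expand[OF assms(2)] kdiff_sum ..
  finally show ?thesis .
qed

lemma kdiff_emb_0: "kdiff (N \<beta>) (X \<beta>) (emb 0 v \<beta>) U = 0"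
  unfolding emb_deg0 kdiff_def contr_def by (auto intro!: sum.neutral)


section \<open>The product of the resolution\<close>

lemma emb_divisible:
  assumes "1 \<le> i" "v \<in> fmod V rk i" "i = 1 \<Longrightarrow> S \<noteq> {0}"
  shows "\<exists>u\<in>polyring V. emb i v \<beta> S = tw \<beta> * u"
proof -
  show ?thesis
  proof (cases "S \<subseteq> N \<beta> \<and> card S = i")
    case True
    then have "S \<noteq> {0}" using assms(3) by auto
    then have "emb i v \<beta> S = tw \<beta> * v (idx i (\<beta>, S))"
      using True assms(1) by (simp add: emb_def)
    then show ?thesis using fmodD(1)[OF assms(2)] by blast
  next
    case False
    then have "emb i v \<beta> S = tw \<beta> * 0" by (simp add: emb_def)
    then show ?thesis by blast
  qed
qed

text \<open>Only the component at \<open>{0}\<close> in degree 1 can fail to be divisible by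
  \<open>tw \<beta>\<close>. Since \<open>S\<close> and \<open>U - S\<close> are disjoint, they are
  not both \<open>{0}\<close>, and every summand has a divisible factor.\<close>

lemma wedge_emb_divisible:
  fixes v w :: "nat \<Rightarrow> 'k::comm_ring_1 mpoly"
  assumes "1 \<le> i" "1 \<le> j" "v \<in> fmod V rk i" "w \<in> fmod V rk j"
  shows "\<exists>u\<in>polyring V. wedge (emb i v \<beta>) (emb j w \<beta>) U = tw \<beta> * u"
proof -
  have "\<exists>u\<in>polyring V. shsgn S (U - S) * emb i v \<beta> S * emb j w \<beta> (U - S) = tw \<beta> * u" for S
  proof (cases "S = {0}")
    case True
    then have "0 \<notin> U - S" by blast
    then have "U - S \<noteq> {0}" by (metis singletonI)
    then obtain u where u: "u \<in> polyring V" "emb j w \<beta> (U - S) = tw \<beta> * u"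
      using emb_divisible[OF assms(2,4), of "U - S" \<beta>] by auto
    show ?thesis
    proof
      show "shsgn S (U - S) * emb i v \<beta> S * emb j w \<beta> (U - S) = tw \<beta> * (shsgn S (U - S) * emb i v \<beta> S * u)"
        unfolding u(2) by (simp only: ac_simps)
    qed (intro polyring_mult polyring_shsgn u(1) emb_polyring[OF assms(3)])
  next
    case False
    then obtain u where u: "u \<in> polyring V" "emb i v \<beta> S = tw \<beta> * u"
      using emb_divisible[OF assms(1,3), of S \<beta>] by auto
    show ?thesis
    proof
      show "shsgn S (U - S) * emb i v \<beta> S * emb j w \<beta> (U - S) = tw \<beta> * (shsgn S (U - S) * u * emb j w \<beta> (U - S))"
        unfolding u(2) by (simp only: ac_simps)
    qed (intro polyring_mult polyring_shsgn u(1) emb_polyring[OF assms(4)])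
  qed
  then obtain h where h: "\<And>S. h S \<in> polyring V"
    "\<And>S. shsgn S (U - S) * emb i v \<beta> S * emb j w \<beta> (U - S) = tw \<beta> * h S"
    by metis
  show ?thesis
    unfolding wedge_def h(2) sum_distrib_left[symmetric] by (rule bexI, rule refl, intro polyring_sum h(1))
qed

lemma wedge_emb_support:
  assumes "\<not> (U \<subseteq> N \<beta> \<and> card U = i + j)"
  shows "wedge (emb i v \<beta>) (emb j w \<beta>) U = 0"
proof (rule ccontr)
  assume nz: "wedge (emb i v \<beta>) (emb j w \<beta>) U \<noteq> 0"
  then have "card U = i + j"
    using hom_deg_wedge[OF hom_deg_emb[of i v \<beta>] hom_deg_emb[of j w \<beta>]] by (simp add: hom_deg_def)
  moreover obtain S where "S \<subseteq> U" "emb i v \<beta> S \<noteq> 0" "emb j w \<beta> (U - S) \<noteq> 0"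
    using nz by (rule wedge_nonzero)
  then have "U \<subseteq> N \<beta>" using emb_support[of S \<beta> i v] emb_support[of "U - S" \<beta> j w] by blast
  ultimately show False using assms by simp
qed

text \<open>In degree 0 the embedding is the diagonal scalar without a twist, and multiplying by it
  just rescales the coordinates. Otherwise the product lies in degree at least 2, where divisibility
  by \<open>tw \<beta>\<close> suffices for a preimage.\<close>

lemma emb_wedge_closed:
  fixes v w :: "nat \<Rightarrow> 'k::comm_ring_1 mpoly"
  assumes "v \<in> fmod V rk i" "w \<in> fmod V rk j"
  shows "\<exists>m\<in>fmod V rk (i + j). \<forall>\<beta> U. emb (i + j) m \<beta> U = wedge (emb i v \<beta>) (emb j w \<beta>) U"
proof -
  have fin: "\<not> finite U \<Longrightarrow> wedge x y U = 0" for x y :: "nat set \<Rightarrow> 'k mpoly" and U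
    by (simp add: wedge_def)
  consider "i = 0" | "j = 0" | "1 \<le> i" "1 \<le> j" by linarith
  then show ?thesis
  proof cases
    case 1
    have "(\<lambda>p. v 0 * w p) \<in> fmod V rk (i + j)"
      using assms 1 by (auto simp: fmod_def)
    moreover have "emb (i + j) (\<lambda>p. v 0 * w p) \<beta> U = wedge (emb i v \<beta>) (emb j w \<beta>) U" for \<beta> U
      by (cases "finite U") (simp_all add: 1 emb_scale emb_deg0 wedge_scalar_left emb_infinite fin)
    ultimately show ?thesis by blast
  next
    case 2
    have "(\<lambda>p. w 0 * v p) \<in> fmod V rk (i + j)"
      using assms 2 by (auto simp: fmod_def)
    moreover have "emb (i + j) (\<lambda>p. w 0 * v p) \<beta> U = wedge (emb i v \<beta>) (emb j w \<beta>) U" for \<beta> U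
      by (cases "finite U") (simp_all add: 2 emb_scale emb_deg0 wedge_scalar_right emb_infinite fin)
    ultimately show ?thesis by blast
  next
    case 3
    obtain u where u: "\<And>\<beta> U. u \<beta> U \<in> polyring V"
      "\<And>\<beta> U. wedge (emb i v \<beta>) (emb j w \<beta>) U = tw \<beta> * u \<beta> U"
      using wedge_emb_divisible[OF 3 assms] by metis
    have "2 \<le> i + j" using 3 by simp
    then obtain m where m: "m \<in> fmod V rk (i + j)"
      "\<And>\<beta> U. emb (i + j) m \<beta> U = (if U \<subseteq> N \<beta> \<and> card U = i + j then tw \<beta> * u \<beta> U else 0)"
      using emb_surj[of "i + j" u] u(1) by blast
    have "emb (i + j) m \<beta> U = wedge (emb i v \<beta>) (emb j w \<beta>) U" for \<beta> U
      using m(2)[of \<beta> U] u(2)[of \<beta> U] wedge_emb_support[of U \<beta> i j v w]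
      by (cases "U \<subseteq> N \<beta> \<and> card U = i + j") simp_all
    then show ?thesis using m(1) by blast
  qed
qed

text \<open>The preimage of the product of two basis elements; it is unique because the embedding is
  injective. Indices out of range get 0, so that all structure constants lie in the ring.\<close>

definition mu :: "nat \<Rightarrow> nat \<Rightarrow> nat \<Rightarrow> nat \<Rightarrow> nat \<Rightarrow> 'k::comm_ring_1 mpoly" where
  "mu i j p q = (if p < rk i \<and> q < rk j then
     (SOME m. m \<in> fmod V rk (i + j) \<and>
        (\<forall>\<beta> U. emb (i + j) m \<beta> U = wedge (emb i (unitv p) \<beta>) (emb j (unitv q) \<beta>) U)) else (\<lambda>_. 0))"

lemma mu_spec:
  assumes "p < rk i" "q < rk j"
  shows "(mu i j p q :: nat \<Rightarrow> 'k::comm_ring_1 mpoly) \<in> fmod V rk (i + j) \<and>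
    (\<forall>\<beta> U. emb (i + j) (mu i j p q :: nat \<Rightarrow> 'k mpoly) \<beta> U = wedge (emb i (unitv p) \<beta>) (emb j (unitv q) \<beta>) U)"
proof -
  have "\<exists>m :: nat \<Rightarrow> 'k mpoly. m \<in> fmod V rk (i + j) \<and>
        (\<forall>\<beta> U. emb (i + j) m \<beta> U = wedge (emb i (unitv p) \<beta>) (emb j (unitv q) \<beta>) U)"
    using emb_wedge_closed[OF unitv_fmod[OF assms(1)] unitv_fmod[OF assms(2)]] by blast
  from someI_ex[OF this] show ?thesis using assms by (simp add: mu_def)
qed

lemma mu_fmod: "(mu i j p q :: nat \<Rightarrow> 'k::comm_ring_1 mpoly) \<in> fmod V rk (i + j)"
proof (cases "p < rk i \<and> q < rk j")
  case False
  then have "mu i j p q = (\<lambda>_. 0 :: 'k mpoly)" by (auto simp: mu_def)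
  then show ?thesis by (simp add: fmod_def)
qed (use mu_spec in blast)

lemma mult_fmod:
  assumes "v \<in> fmod V rk i" "w \<in> fmod V rk j"
  shows "mult rk mu i j v w \<in> fmod V rk (i + j)"
  using fmodD(1)[OF assms(1)] fmodD(1)[OF assms(2)] fmodD(1)[OF mu_fmod]
  by (auto simp: fmod_def mult_def intro!: polyring_sum polyring_mult)

lemma emb_mult:
  fixes v w :: "nat \<Rightarrow> 'k::comm_ring_1 mpoly"
  assumes "v \<in> fmod V rk i" "w \<in> fmod V rk j"
  shows "emb (i + j) (mult rk mu i j v w) \<beta> U = wedge (emb i v \<beta>) (emb j w \<beta>) U"
proof -
  have "mult rk mu i j v w = (\<lambda>s. \<Sum>p<rk i. v p * (\<Sum>q<rk j. w q * mu i j p q s))"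
  proof
    fix s
    show "mult rk mu i j v w s = (\<Sum>p<rk i. v p * (\<Sum>q<rk j. w q * mu i j p q s))"
      using fmodD(2)[OF mu_fmod[where 'k = 'k], of i j s]
      by (auto simp: mult_def sum_distrib_left mult.assoc)
  qed
  then have "emb (i + j) (mult rk mu i j v w) \<beta> U
      = (\<Sum>p<rk i. v p * (\<Sum>q<rk j. w q * emb (i + j) (mu i j p q) \<beta> U))"
    by (simp add: emb_sum)
  also have "\<dots> = (\<Sum>p<rk i. v p * (\<Sum>q<rk j. w q * wedge (emb i (unitv p) \<beta>) (emb j (unitv q) \<beta>) U))"
    by (intro sum.cong refl arg_cong2[where f = "(*)"]) (simp add: mu_spec)
  also have "\<dots> = wedge (emb i v \<beta>) (emb j w \<beta>) U"
    unfolding emb_expand[OF assms(1)] emb_expand[OF assms(2)] wedge_sum_left wedge_sum_right ..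
  finally show ?thesis .
qed

lemma emb_mult_fun:
  assumes "v \<in> fmod V rk i" "w \<in> fmod V rk j"
  shows "emb (i + j) (mult rk mu i j v w) \<beta> = wedge (emb i v \<beta>) (emb j w \<beta>)"
  using emb_mult[OF assms] by auto

lemma emb_diff_fun:
  assumes "1 \<le> i" "v \<in> fmod V rk i"
  shows "emb (i - 1) (diff dmat rk i v) \<beta> = kdiff (N \<beta>) (X \<beta>) (emb i v \<beta>)"
  using emb_diff[OF assms] by auto

section \<open>The laws of a dg algebra\<close>

lemma fmod_add: "v \<in> fmod W r i \<Longrightarrow> w \<in> fmod W r i \<Longrightarrow> (\<lambda>s. v s + w s) \<in> fmod W r i"
  for v w :: "nat \<Rightarrow> 'k::comm_ring_1 mpoly"
  by (auto simp: fmod_def)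

lemma fmod_sign: "v \<in> fmod W r i \<Longrightarrow> (\<lambda>s. (- 1) ^ n * v s) \<in> fmod W r i"
  for v :: "nat \<Rightarrow> 'k::comm_ring_1 mpoly"
  by (cases "even n") (auto simp: fmod_def)

text \<open>Both sides have the same image in the product of the Koszul algebras, where the law is
  \<open>wedge_assoc\<close>. The laws that follow are transferred in the same way.\<close>

lemma mult_assoc_law:
  fixes v w x :: "nat \<Rightarrow> 'k::comm_ring_1 mpoly"
  assumes "v \<in> fmod V rk i" "w \<in> fmod V rk j" "x \<in> fmod V rk k"
  shows "mult rk mu (i + j) k (mult rk mu i j v w) x = mult rk mu i (j + k) v (mult rk mu j k w x)"
proof (rule emb_inj[of _ "i + (j + k)"])
  note vw = mult_fmod[OF assms(1,2)] and wx = mult_fmod[OF assms(2,3)]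
  show "mult rk mu (i + j) k (mult rk mu i j v w) x \<in> fmod V rk (i + (j + k))"
    using mult_fmod[OF vw assms(3)] by (simp add: add.assoc)
  show "mult rk mu i (j + k) v (mult rk mu j k w x) \<in> fmod V rk (i + (j + k))"
    using mult_fmod[OF assms(1) wx] .
  fix \<beta> U
  have "emb (i + j + k) (mult rk mu (i + j) k (mult rk mu i j v w) x) \<beta> U
      = wedge (wedge (emb i v \<beta>) (emb j w \<beta>)) (emb k x \<beta>) U"
    by (simp only: emb_mult_fun[OF vw assms(3)] emb_mult_fun[OF assms(1,2)])
  moreover have "emb (i + (j + k)) (mult rk mu i (j + k) v (mult rk mu j k w x)) \<beta> U
      = wedge (emb i v \<beta>) (wedge (emb j w \<beta>) (emb k x \<beta>)) U"
    by (simp only: emb_mult_fun[OF assms(1) wx] emb_mult_fun[OF assms(2,3)])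
  ultimately show "emb (i + (j + k)) (mult rk mu (i + j) k (mult rk mu i j v w) x) \<beta> U
      = emb (i + (j + k)) (mult rk mu i (j + k) v (mult rk mu j k w x)) \<beta> U"
    by (simp add: wedge_assoc add.assoc)
qed

lemma mult_commute_law:
  fixes v w :: "nat \<Rightarrow> 'k::comm_ring_1 mpoly"
  assumes "v \<in> fmod V rk i" "w \<in> fmod V rk j"
  shows "mult rk mu i j v w = (\<lambda>s. (- 1) ^ (i * j) * mult rk mu j i w v s)"
proof (rule emb_inj[OF mult_fmod[OF assms]])
  show "(\<lambda>s. (- 1) ^ (i * j) * mult rk mu j i w v s) \<in> fmod V rk (i + j)"
    using mult_fmod[OF assms(2,1)] by (intro fmod_sign) (simp add: add.commute)
  fix \<beta> U
  show "emb (i + j) (mult rk mu i j v w) \<beta> U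
      = emb (i + j) (\<lambda>s. (- 1) ^ (i * j) * mult rk mu j i w v s) \<beta> U"
    unfolding emb_scale emb_mult[OF assms] emb_mult[OF assms(2,1), unfolded add.commute[of j i]]
    by (rule wedge_commute[OF hom_deg_emb hom_deg_emb])
qed

lemma mult_self_odd:
  fixes v :: "nat \<Rightarrow> 'k::comm_ring_1 mpoly"
  assumes "odd i" "v \<in> fmod V rk i"
  shows "mult rk mu i i v v = (\<lambda>_. 0)"
  by (rule emb_inj_zero[OF mult_fmod[OF assms(2,2)]])
     (simp add: emb_mult[OF assms(2,2)] wedge_self_odd[OF hom_deg_emb assms(1)])

lemma mult_unit:
  fixes v :: "nat \<Rightarrow> 'k::comm_ring_1 mpoly"
  assumes "v \<in> fmod V rk j"
  shows "mult rk mu 0 j (unitv 0) v = v" "mult rk mu j 0 v (unitv 0) = v"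
proof -
  have u: "unitv 0 \<in> fmod V rk 0" by (rule unitv_fmod) (simp add: rk_0)
  have e: "emb 0 (unitv 0 :: nat \<Rightarrow> 'k mpoly) \<beta> = (\<lambda>U. if U = {} then 1 else 0)" for \<beta>
    by (auto simp: fun_eq_iff emb_deg0 unitv_def)
  have fin: "\<not> finite U \<Longrightarrow> wedge x y U = 0" for x y :: "nat set \<Rightarrow> 'k mpoly" and U
    by (simp add: wedge_def)
  show "mult rk mu 0 j (unitv 0) v = v"
  proof (rule emb_inj[OF _ assms])
    show "mult rk mu 0 j (unitv 0) v \<in> fmod V rk j" using mult_fmod[OF u assms] by simp
    fix \<beta> U
    show "emb j (mult rk mu 0 j (unitv 0) v) \<beta> U = emb j v \<beta> U"
      using emb_mult[OF u assms, of \<beta> U]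
      by (cases "finite U") (simp_all add: e wedge_scalar_left fin emb_infinite)
  qed
  show "mult rk mu j 0 v (unitv 0) = v"
  proof (rule emb_inj[OF _ assms])
    show "mult rk mu j 0 v (unitv 0) \<in> fmod V rk j" using mult_fmod[OF assms u] by simp
    fix \<beta> U
    show "emb j (mult rk mu j 0 v (unitv 0)) \<beta> U = emb j v \<beta> U"
      using emb_mult[OF assms u, of \<beta> U]
      by (cases "finite U") (simp_all add: e wedge_scalar_right fin emb_infinite)
  qed
qed

lemma mult_zero: "mult r m i j (\<lambda>_. 0) w = (\<lambda>_. 0)" "mult r m i j v (\<lambda>_. 0) = (\<lambda>_. 0)"
  by (simp_all add: mult_def fun_eq_iff)

lemma diff_0: "diff d r 0 v = (\<lambda>_. 0)"
  by (simp add: diff_def)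

lemma wedge_zero: "wedge (\<lambda>_. 0) w U = 0" "wedge v (\<lambda>_. 0) U = 0"
  by (simp_all add: wedge_def)

text \<open>For \<open>i = 0\<close> the truncated \<open>i - 1\<close> is 0 and the stated degree
  \<open>i + j - 1\<close> is not that of the product. This is harmless, as the differential and
  hence the product are then zero.\<close>

lemma emb_mult_diff_left:
  fixes v w :: "nat \<Rightarrow> 'k::comm_ring_1 mpoly"
  assumes "v \<in> fmod V rk i" "w \<in> fmod V rk j"
  shows "mult rk mu (i - 1) j (diff dmat rk i v) w \<in> fmod V rk (i + j - 1)"
    and "emb (i + j - 1) (mult rk mu (i - 1) j (diff dmat rk i v) w) \<beta> U
      = wedge (kdiff (N \<beta>) (X \<beta>) (emb i v \<beta>)) (emb j w \<beta>) U"
proof -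
  have "mult rk mu (i - 1) j (diff dmat rk i v) w \<in> fmod V rk (i + j - 1) \<and>
    emb (i + j - 1) (mult rk mu (i - 1) j (diff dmat rk i v) w) \<beta> U
      = wedge (kdiff (N \<beta>) (X \<beta>) (emb i v \<beta>)) (emb j w \<beta>) U"
  proof (cases "i = 0")
    case True
    have "kdiff (N \<beta>) (X \<beta>) (emb 0 v \<beta>) = (\<lambda>_. 0)" using kdiff_emb_0 by blast
    then show ?thesis by (simp add: True diff_0 mult_zero emb_zero wedge_zero fmod_def)
  next
    case False
    then have i: "1 \<le> i" "i + j - 1 = i - 1 + j" by auto
    note d = diff_fmod[OF assms(1)]
    show ?thesis
      unfolding i(2) emb_mult[OF d assms(2)] emb_diff_fun[OF i(1) assms(1)]
      using mult_fmod[OF d assms(2)] by simp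
  qed
  then show "mult rk mu (i - 1) j (diff dmat rk i v) w \<in> fmod V rk (i + j - 1)"
    and "emb (i + j - 1) (mult rk mu (i - 1) j (diff dmat rk i v) w) \<beta> U
      = wedge (kdiff (N \<beta>) (X \<beta>) (emb i v \<beta>)) (emb j w \<beta>) U" by auto
qed

lemma emb_mult_diff_right:
  fixes v w :: "nat \<Rightarrow> 'k::comm_ring_1 mpoly"
  assumes "v \<in> fmod V rk i" "w \<in> fmod V rk j"
  shows "mult rk mu i (j - 1) v (diff dmat rk j w) \<in> fmod V rk (i + j - 1)"
    and "emb (i + j - 1) (mult rk mu i (j - 1) v (diff dmat rk j w)) \<beta> U
      = wedge (emb i v \<beta>) (kdiff (N \<beta>) (X \<beta>) (emb j w \<beta>)) U"
proof -
  have "mult rk mu i (j - 1) v (diff dmat rk j w) \<in> fmod V rk (i + j - 1) \<and>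
    emb (i + j - 1) (mult rk mu i (j - 1) v (diff dmat rk j w)) \<beta> U
      = wedge (emb i v \<beta>) (kdiff (N \<beta>) (X \<beta>) (emb j w \<beta>)) U"
  proof (cases "j = 0")
    case True
    have "kdiff (N \<beta>) (X \<beta>) (emb 0 w \<beta>) = (\<lambda>_. 0)" using kdiff_emb_0 by blast
    then show ?thesis by (simp add: True diff_0 mult_zero emb_zero wedge_zero fmod_def)
  next
    case False
    then have j: "1 \<le> j" "i + j - 1 = i + (j - 1)" by auto
    note d = diff_fmod[OF assms(2)]
    show ?thesis
      unfolding j(2) emb_mult[OF assms(1) d] emb_diff_fun[OF j(1) assms(2)]
      using mult_fmod[OF assms(1) d] by simp
  qed
  then show "mult rk mu i (j - 1) v (diff dmat rk j w) \<in> fmod V rk (i + j - 1)"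
    and "emb (i + j - 1) (mult rk mu i (j - 1) v (diff dmat rk j w)) \<beta> U
      = wedge (emb i v \<beta>) (kdiff (N \<beta>) (X \<beta>) (emb j w \<beta>)) U" by auto
qed

lemma mult_leibniz:
  fixes v w :: "nat \<Rightarrow> 'k::comm_ring_1 mpoly"
  assumes "v \<in> fmod V rk i" "w \<in> fmod V rk j"
  shows "diff dmat rk (i + j) (mult rk mu i j v w) =
          (\<lambda>s. mult rk mu (i - 1) j (diff dmat rk i v) w s
               + (- 1) ^ i * mult rk mu i (j - 1) v (diff dmat rk j w) s)"
proof (cases "i + j = 0")
  case True
  then show ?thesis by (simp add: diff_0 mult_zero)
next
  case False
  then have ij: "1 \<le> i + j" by linarith
  note vw = mult_fmod[OF assms] and L = emb_mult_diff_left[OF assms] and R = emb_mult_diff_right[OF assms]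
  show ?thesis
  proof (rule emb_inj[OF diff_fmod[OF vw]])
    show "(\<lambda>s. mult rk mu (i - 1) j (diff dmat rk i v) w s
        + (- 1) ^ i * mult rk mu i (j - 1) v (diff dmat rk j w) s) \<in> fmod V rk (i + j - 1)"
      by (intro fmod_add fmod_sign L(1) R(1))
    fix \<beta> U
    show "emb (i + j - 1) (diff dmat rk (i + j) (mult rk mu i j v w)) \<beta> U
      = emb (i + j - 1) (\<lambda>s. mult rk mu (i - 1) j (diff dmat rk i v) w s
        + (- 1) ^ i * mult rk mu i (j - 1) v (diff dmat rk j w) s) \<beta> U"
    proof (cases "finite U")
      case True
      then show ?thesis
        unfolding emb_add emb_scale L(2) R(2) emb_diff[OF ij vw] emb_mult_fun[OF assms]
        by (rule kdiff_wedge[OF _ hom_deg_emb])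
    qed (simp add: emb_infinite)
  qed
qed

lemma dg_algebra:
  "dg_algebra_structure V rk (dmat :: nat \<Rightarrow> nat \<Rightarrow> nat \<Rightarrow> 'k::comm_ring_1 mpoly) mu"
  unfolding dg_algebra_structure_def
proof (intro conjI allI ballI impI)
  show "mu i j p q s \<in> polyring V" for i j p q s
    using fmodD(1)[OF mu_fmod] .
  show "\<exists>u\<in>fmod V rk 0. \<forall>j. \<forall>v\<in>fmod V rk j. mult rk mu 0 j u v = (v :: nat \<Rightarrow> 'k mpoly) \<and> mult rk mu j 0 v u = v"
    by (rule bexI[of _ "unitv 0"]) (auto simp: mult_unit rk_0 intro!: unitv_fmod)
qed (fact mult_assoc_law mult_commute_law mult_self_odd mult_leibniz)+

section \<open>Exactness of the resolution\<close>

lemma emb_cycle_divisible: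
  fixes v :: "nat \<Rightarrow> 'k::comm_ring_1 mpoly"
  assumes "1 \<le> i" "v \<in> fmod V rk i" "diff dmat rk i v = (\<lambda>_. 0)"
  shows "\<exists>u\<in>polyring V. emb i v \<beta> S = tw \<beta> * u"
proof (cases "i = 1 \<and> S = {0}")
  case False
  then show ?thesis using emb_divisible[OF assms(1,2)] by blast
next
  case True
  then have i: "i = 1" and S: "S = {0}" by auto
  \<comment> \<open>The exceptional component is divisible for cycles. All summands of the cycle
    condition other than that of index 0 are multiples of \<open>tw \<beta>\<close>; the remaining
    one has the factor \<open>tw (\<not> \<beta>)\<close>, a different variable, which can be
    cancelled.\<close>
  have "kdiff (N \<beta>) (X \<beta>) (emb 1 v \<beta>) {} = 0"
    using emb_diff[OF assms(1,2), of \<beta> "{}"] assms(3) i by (simp add: emb_zero)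
  then have "(\<Sum>s\<in>N \<beta>. X \<beta> s * emb 1 v \<beta> {s}) = 0"
    by (simp add: kdiff_def contr_def)
  then have "tw (\<not> \<beta>) * emb 1 v \<beta> {0} + (\<Sum>s\<in>{1..nv \<beta>}. X \<beta> s * emb 1 v \<beta> {s}) = 0"
    by (simp add: N_eq vv_0)
  then have "tw (\<not> \<beta>) * emb 1 v \<beta> {0} = - (\<Sum>s\<in>{1..nv \<beta>}. X \<beta> s * emb 1 v \<beta> {s})"
    by (simp add: eq_neg_iff_add_eq_0)
  also have "\<dots> = - (\<Sum>s\<in>{1..nv \<beta>}. tw \<beta> * (X \<beta> s * v (idx 1 (\<beta>, {s}))))"
    by (intro arg_cong[where f = uminus] sum.cong refl) (simp add: emb_deg1_pos mult.left_commute)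
  finally have "touch {twv \<beta>} (tw (\<not> \<beta>) * emb 1 v \<beta> {0})"
    by (metis (no_types, lifting) touch_uminus touch_sum touch_pvar_mult singletonI)
  \<comment> \<open>A one-element index set turns \<open>touch_decompose\<close> into division by a
    single variable.\<close>
  then have "touch ((\<lambda>_. twv \<beta>) ` {()}) (emb 1 v \<beta> {0})"
    using touch_cancel twv_not by (metis image_insert image_empty singletonD)
  then obtain g where "\<forall>i. g i \<in> polyring V" "emb 1 v \<beta> {0} = (\<Sum>i\<in>{()}. tw \<beta> * g i)"
    using touch_decompose[of "{()}" "\<lambda>_. twv \<beta>" "emb 1 v \<beta> {0}" V] emb_polyring[OF assms(2), of \<beta> "{0}"]
      twv_V i by auto
  then show ?thesis using i S by auto
qed

text \<open>The primitive given by \<open>koszul_exact\<close> may have components in several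
  degrees. Since the differential lowers the degree by one, the primitive can be cut down to the
  right degree.\<close>

lemma kdiff_restrict:
  assumes "finite U"
  shows "kdiff M Y (\<lambda>S. if card S = Suc n then w S else 0) U = (if card U = n then kdiff M Y w U else 0)"
  using assms by (auto simp: kdiff_def contr_def intro!: sum.neutral sum.cong)

text \<open>Dividing the image of a cycle by \<open>tw \<beta>\<close> gives a Koszul cycle on each
  side. Koszul primitives, multiplied by \<open>tw \<beta>\<close> again, lie in the image of the
  embedding because their degree is at least 2.\<close>

lemma cycle_is_boundary:
  fixes v :: "nat \<Rightarrow> 'k::comm_ring_1 mpoly"
  assumes i: "1 \<le> i" and v: "v \<in> fmod V rk i" and cyc: "diff dmat rk i v = (\<lambda>_. 0)"
  shows "v \<in> diff dmat rk (i + 1) ` fmod V rk (i + 1)"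
proof -
  obtain u where u: "\<And>\<beta> S. u \<beta> S \<in> polyring V" "\<And>\<beta> S. emb i v \<beta> S = tw \<beta> * u \<beta> S"
    using emb_cycle_divisible[OF assms] by metis
  have u0: "u \<beta> S = 0" if "emb i v \<beta> S = 0" for \<beta> S
    using u(2)[of \<beta> S] that by (simp add: pvar_mult_eq_0)
  have "\<forall>\<beta>. \<exists>w. (\<forall>S. \<not> S \<subseteq> N \<beta> \<longrightarrow> w S = 0) \<and> (\<forall>S. w S \<in> polyring V) \<and> w {} = 0 \<and>
      (\<forall>U. kdiff (N \<beta>) (X \<beta>) w U = u \<beta> U)"
  proof (rule allI, rule koszul_exact[OF finite_N inj_vv vv_V order_refl])
    fix \<beta>
    show "u \<beta> S = 0" if "\<not> S \<subseteq> N \<beta>" for S using that by (intro u0 emb_support)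
    show "u \<beta> {} = 0" using i by (intro u0) (simp add: emb_def)
    fix U
    have "emb i v \<beta> = (\<lambda>S. tw \<beta> * u \<beta> S)" using u(2) by (rule ext)
    then have "tw \<beta> * kdiff (N \<beta>) (X \<beta>) (u \<beta>) U = kdiff (N \<beta>) (X \<beta>) (emb i v \<beta>) U"
      by (simp only: kdiff_scale)
    also have "\<dots> = 0"
      using emb_diff[OF i v, of \<beta> U] cyc by (simp add: emb_zero)
    finally show "kdiff (N \<beta>) (X \<beta>) (u \<beta>) U = 0" by (simp add: pvar_mult_eq_0)
  qed (rule u(1))
  from choice[OF this] obtain w where w: "\<And>\<beta> S. \<not> S \<subseteq> N \<beta> \<Longrightarrow> w \<beta> S = 0" "\<And>\<beta> S. w \<beta> S \<in> polyring V"
    "\<And>\<beta> U. kdiff (N \<beta>) (X \<beta>) (w \<beta>) U = u \<beta> U" by blast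
  obtain v' where v': "v' \<in> fmod V rk (i + 1)"
    "\<And>\<beta> U. emb (i + 1) v' \<beta> U = (if U \<subseteq> N \<beta> \<and> card U = i + 1 then tw \<beta> * w \<beta> U else 0)"
  proof (rule emb_surj[of "i + 1" w])
    show "2 \<le> i + 1" using i by linarith
  qed (auto intro: w(2))
  have e: "emb (i + 1) v' \<beta> = (\<lambda>U. tw \<beta> * (if card U = Suc i then w \<beta> U else 0))" for \<beta>
    using v'(2) w(1) by (auto simp: fun_eq_iff)
  have "diff dmat rk (i + 1) v' = v"
  proof (rule emb_inj)
    show "diff dmat rk (i + 1) v' \<in> fmod V rk i" using diff_fmod[OF v'(1)] by simp
    show "v \<in> fmod V rk i" by (rule v)
    fix \<beta> U
    show "emb i (diff dmat rk (i + 1) v') \<beta> U = emb i v \<beta> U"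
    proof (cases "finite U")
      case True
      have "emb i (diff dmat rk (i + 1) v') \<beta> U = kdiff (N \<beta>) (X \<beta>) (emb (i + 1) v' \<beta>) U"
        using emb_diff[OF _ v'(1), of \<beta> U] by simp
      also have "\<dots> = tw \<beta> * (if card U = i then u \<beta> U else 0)"
        unfolding e kdiff_scale kdiff_restrict[OF True] w(3) ..
      also have "\<dots> = emb i v \<beta> U"
      proof (cases "card U = i")
        case False
        then have "emb i v \<beta> U = 0" by (simp add: emb_def)
        then show ?thesis using False by simp
      qed (simp add: u(2))
      finally show ?thesis .
    qed (simp add: emb_infinite)
  qed
  then show ?thesis using v'(1) by blast
qed

lemma diff_diff:
  fixes w :: "nat \<Rightarrow> 'k::comm_ring_1 mpoly"
  assumes "1 \<le> i" "w \<in> fmod V rk (i + 1)"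
  shows "diff dmat rk i (diff dmat rk (i + 1) w) = (\<lambda>_. 0)"
proof (rule emb_inj_zero)
  have d: "diff dmat rk (i + 1) w \<in> fmod V rk i" using diff_fmod[OF assms(2)] by simp
  show "diff dmat rk i (diff dmat rk (i + 1) w) \<in> fmod V rk (i - 1)" by (rule diff_fmod[OF d])
  fix \<beta> U
  have "emb i (diff dmat rk (i + 1) w) \<beta> = kdiff (N \<beta>) (X \<beta>) (emb (i + 1) w \<beta>)"
    using emb_diff_fun[OF _ assms(2), of \<beta>] by simp
  then show "emb (i - 1) (diff dmat rk i (diff dmat rk (i + 1) w)) \<beta> U = 0"
    by (cases "finite U") (simp add: emb_diff[OF assms(1) d] kdiff_kdiff, simp add: emb_infinite)
qed

section \<open>The edge ideal, minimality and conclusion\<close>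

definition edge :: "bool \<times> nat set \<Rightarrow> vtx \<times> vtx" where
  "edge B = (twv (fst B), vv (fst B) (the_elem (snd B)))"

lemma edge_image: "edge ` Bas 1 = Ledges a b c"
proof -
  have vF: "vv False ` {1..nv False} = VXi ` {1..a} \<union> VZk ` {1..c}"
  proof -
    \<comment> \<open>The upper \<open>c\<close> indices are the z_k shifted by the number of
      leaves.\<close>
    have "{1..nv False} = {1..a} \<union> (\<lambda>k. a + k) ` {1..c}"
      unfolding nv_def lv_def by (auto simp: image_add_atLeastAtMost)
    moreover have "vv False ` {1..a} = VXi ` {1..a}" by (rule image_cong) (auto simp: vv_def lv_def)
    moreover have "vv False ` (\<lambda>k. a + k) ` {1..c} = VZk ` {1..c}"
      unfolding image_image by (rule image_cong) (auto simp: vv_def lv_def)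
    ultimately show ?thesis by (simp add: image_Un)
  qed
  have vT: "vv True ` {1..nv True} = VYj ` {1..b} \<union> VZk ` {1..c}"
  proof -
    have "{1..nv True} = {1..b} \<union> (\<lambda>k. b + k) ` {1..c}"
      unfolding nv_def lv_def by (auto simp: image_add_atLeastAtMost)
    moreover have "vv True ` {1..b} = VYj ` {1..b}" by (rule image_cong) (auto simp: vv_def lv_def)
    moreover have "vv True ` (\<lambda>k. b + k) ` {1..c} = VZk ` {1..c}"
      unfolding image_image by (rule image_cong) (auto simp: vv_def lv_def)
    ultimately show ?thesis by (simp add: image_Un)
  qed
  have "Bas 1 = insert (False, {0}) ((\<lambda>s. (False, {s})) ` {1..nv False} \<union> (\<lambda>s. (True, {s})) ` {1..nv True})"
  proof -
    have "{(\<beta>, {s}) | \<beta> s. s \<in> {1..nv \<beta>}} = (\<Union>\<beta>. (\<lambda>s. (\<beta>, {s})) ` {1..nv \<beta>})" by blast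
    then show ?thesis by (simp add: Bas_def UNIV_bool)
  qed
  then have "edge ` Bas 1 = insert (VX, VY) (Pair VX ` vv False ` {1..nv False} \<union> Pair VY ` vv True ` {1..nv True})"
    by (simp add: image_Un image_image edge_def twv_def vv_0)
  also have "\<dots> = Ledges a b c"
    unfolding vF vT Ledges_def by (auto simp: image_Un image_image)
  finally show ?thesis .
qed

lemma edge_inj: "inj_on edge (Bas 1)"
proof
  have N: "\<exists>s. snd B = {s} \<and> s \<in> N (fst B)" if "B \<in> Bas 1" for B
    using that by (auto simp: Bas_def N_def)
  fix B C assume BC: "B \<in> Bas 1" "C \<in> Bas 1" "edge B = edge C"
  obtain s where s: "snd B = {s}" "s \<in> N (fst B)" using N[OF BC(1)] by auto
  obtain t where t: "snd C = {t}" "t \<in> N (fst C)" using N[OF BC(2)] by auto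
  have "twv (fst B) = twv (fst C)" using BC(3) by (simp add: edge_def)
  then have f: "fst B = fst C" by (auto simp: twv_def split: if_splits)
  have "vv (fst B) s = vv (fst B) t" using BC(3) f s(1) t(1) by (simp add: edge_def)
  moreover have "t \<in> N (fst B)" using t(2) by (simp only: f)
  ultimately have "s = t" using inj_onD[OF inj_vv _ s(2)] by blast
  then show "B = C" using f s(1) t(1) by (simp add: prod_eq_iff)
qed

lemma dmat_1:
  assumes "q < rk 1"
  shows "dmat 1 0 q = var_mono (fst (edge (en 1 q))) (snd (edge (en 1 q)))"
proof -
  obtain \<beta> s where "en 1 q = (\<beta>, {s})" "s \<in> N \<beta>"
    using en_Bas[OF assms] by (auto simp: Bas_def N_def)
  then show ?thesis using assms
    by (simp add: dmat_def rk_0 K_singleton edge_def var_mono_eq)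
qed

lemma image_diff_1:
  "(\<lambda>v. v 0) ` (diff dmat rk 1 ` fmod V rk 1) = (edge_ideal a b c :: 'k::comm_ring_1 mpoly set)"
proof -
  define h where "h q = edge (en 1 q)" for q
  have h: "bij_betw h {..<rk 1} (Ledges a b c)"
    using bij_betw_trans[OF bij_en[of 1], of edge "Ledges a b c"] edge_inj edge_image
    by (simp add: bij_betw_def h_def[abs_def] comp_def)
  have d: "diff dmat rk 1 v 0 = (\<Sum>q<rk 1. v q * var_mono (fst (h q)) (snd (h q)))"
    for v :: "nat \<Rightarrow> 'k mpoly"
    unfolding diff_def using rk_0 by (auto simp: h_def dmat_1 mult.commute intro!: sum.cong)
  show ?thesis
  proof
    show "(\<lambda>v. v 0) ` (diff dmat rk 1 ` fmod V rk 1) \<subseteq> (edge_ideal a b c :: 'k mpoly set)"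
    proof clarsimp
      fix v :: "nat \<Rightarrow> 'k mpoly" assume v: "v \<in> fmod V rk 1"
      \<comment> \<open>The coefficients are transported along the numbering of the edges. They must
        lie in the ring at non-edges too; whatever index \<open>inv_into\<close> returns there,
        \<open>v\<close> takes all its values in the ring.\<close>
      define g where "g e = v (inv_into {..<rk 1} h e)" for e
      have "diff dmat rk 1 v 0 = (\<Sum>q<rk 1. g (h q) * var_mono (fst (h q)) (snd (h q)))"
        unfolding d g_def using h by (intro sum.cong) (auto simp: bij_betw_def)
      also have "\<dots> = (\<Sum>e\<in>Ledges a b c. g e * var_mono (fst e) (snd e))"
        by (rule sum.reindex_bij_betw[OF h])
      finally show "diff dmat rk 1 v 0 \<in> edge_ideal a b c"
        unfolding edge_ideal_def using fmodD(1)[OF v] by (auto simp: g_def)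
    qed
    show "(edge_ideal a b c :: 'k mpoly set) \<subseteq> (\<lambda>v. v 0) ` (diff dmat rk 1 ` fmod V rk 1)"
    proof
      fix x :: "'k mpoly" assume "x \<in> edge_ideal a b c"
      then obtain g where g: "\<forall>e. g e \<in> polyring V" "x = (\<Sum>e\<in>Ledges a b c. g e * var_mono (fst e) (snd e))"
        unfolding edge_ideal_def by blast
      define v where "v q = (if q < rk 1 then g (h q) else 0)" for q
      have "diff dmat rk 1 v 0 = (\<Sum>q<rk 1. g (h q) * var_mono (fst (h q)) (snd (h q)))"
        unfolding d v_def by (rule sum.cong) auto
      also have "\<dots> = x" unfolding g(2) by (rule sum.reindex_bij_betw[OF h])
      finally have "x = diff dmat rk 1 v 0" ..
      moreover have "v \<in> fmod V rk 1" using g(1) by (simp add: v_def fmod_def del: split_paired_All)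
      ultimately show "x \<in> (\<lambda>v. v 0) ` (diff dmat rk 1 ` fmod V rk 1)" by blast
    qed
  qed
qed

lemma resolution:
  "minimal_free_resolution V (edge_ideal a b c) rk (dmat :: nat \<Rightarrow> nat \<Rightarrow> nat \<Rightarrow> 'k::comm_ring_1 mpoly)"
  unfolding minimal_free_resolution_def
proof (intro conjI allI impI)
  show "rk 0 = 1" by (rule rk_0)
  show "dmat i p q \<in> polyring V" for i p q by (rule polyring_dmat)
  show "(\<lambda>v. v 0) ` (diff dmat rk 1 ` fmod V rk 1) = edge_ideal a b c" by (rule image_diff_1)
  show "{v \<in> fmod V rk i. diff dmat rk i v = (\<lambda>_. 0 :: 'k mpoly)} = diff dmat rk (i + 1) ` fmod V rk (i + 1)"
    if "1 \<le> i" for i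
    using cycle_is_boundary[OF that] diff_diff[OF that] diff_fmod[of _ "i + 1"] by auto
  show "\<exists>dg :: nat \<Rightarrow> nat \<Rightarrow> nat. dg 0 0 = 0 \<and>
        (\<forall>i p q. 1 \<le> i \<longrightarrow> p < rk (i - 1) \<longrightarrow> q < rk i \<longrightarrow>
           (dmat i p q :: 'k mpoly) = 0 \<or> (dg (i - 1) p \<le> dg i q \<and> homogeneous (dg i q - dg (i - 1) p) (dmat i p q :: 'k mpoly)))"
  \<comment> \<open>The resolution is linear: generators in homological degree i > 0 have internal
    degree i + 1. Only the first matrix, whose entries are the edge monomials, jumps by 2.\<close>
  proof (intro exI[of _ "\<lambda>i p. if i = 0 then 0 else i + 1"] conjI allI impI disjI2)
    fix i p q :: nat assume "1 \<le> i"
    then show "homogeneous ((if i = 0 then 0 else i + 1) - (if i - 1 = 0 then 0 else i - 1 + 1)) (dmat i p q :: 'k mpoly)"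
      using homogeneous_dmat[of i p q, where 'k = 'k] by (auto split: if_splits)
  qed auto
  show "Poly_Mapping.lookup (dmat i p q :: 'k mpoly) 0 = 0" for i p q
    by (rule homogeneous_lookup_0[OF homogeneous_dmat[of i]]) simp
qed

end

end

theorem mainTheorem4:
  fixes a b c :: nat
  shows "\<exists>(r :: nat \<Rightarrow> nat) (d :: nat \<Rightarrow> nat \<Rightarrow> nat \<Rightarrow> ('k::field) mpoly).
           minimal_free_resolution (Lverts a b c) (edge_ideal a b c) r d \<and>
           (\<exists>mu. dg_algebra_structure (Lverts a b c) r d mu)"
  using Lgraph.resolution Lgraph.dg_algebra by blast

end
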